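(* In $\mathbb{Z}[t][[u]]$, \[ \sum_{n=0}^\infty Z_{F_n}(t) u^{n}=\frac{2}{\sqrt{(1-(t+1) u)^2-4 t u^2}-(t+1) u+1}, \] where the square root is the power series in $u$ with constant term $1$.
   Context: For a matroid $M$ let $L(M)$ be its lattice of flats, $\mathrm{rk}\, M$ its rank, $\chi_M(t)$ its characteristic polynomial; for a flat $F$, $M_F$ is the localization (restriction to $F$) and $M^F$ the contraction at $F$. The Kazhdan–Lusztig polynomial is the unique assignment of $P_M(t)\in\mathbb{Z}[t]$ to each loopless matroid $M$ with: $P_M=1$ if $\mathrm{rk}\, M=0$; $\deg P_M<\frac12\mathrm{rk}\, M$ if $\mathrm{rk}\, M>0$; $t^{\mathrm{rk}\, M}P_M(t^{-1})=\sum_{F\in L(M)}\chi_{M_F}(t)P_{M^F}(t)$. The $Z$-polynomial is $Z_M(t)=\sum_{F\in L(M)}t^{\mathrm{rk}\, M_F}P_{M^F}(t)$; for a graph $G$, $Z_G=Z_{M(G)}$ for its graphic matroid. The fan graph $F_n$ ($n\ge1$) has vertices $0,1,\dots,n$, edges $\{i,i+1\}$ ($1\le i<n$) and $\{0,i\}$ ($1\le i\le n$); $F_0$ is the single-vertex graph (so $Z_{F_0}=1$). *)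

theory Defs
  imports
    "HOL-Computational_Algebra.Polynomial"
    "HOL-Computational_Algebra.Formal_Power_Series"
    "HOL-Computational_Algebra.Polynomial_Factorial"
begin

section \<open>Matroids\<close>

record 'a indep_system =
  ground :: "'a set"
  indeps :: "'a set set"

locale matroid =
  fixes M :: "'a indep_system"
  assumes finite_ground: "finite (ground M)"
    and indep_subset_ground: "I \<in> indeps M \<Longrightarrow> I \<subseteq> ground M"
    and empty_indep: "{} \<in> indeps M"
    and indep_subset: "I \<in> indeps M \<Longrightarrow> J \<subseteq> I \<Longrightarrow> J \<in> indeps M"
    and augment: "I \<in> indeps M \<Longrightarrow> J \<in> indeps M \<Longrightarrow> card I < card J \<Longrightarrow>
                    \<exists>x\<in>J - I. insert x I \<in> indeps M"

definition loopless :: "'a indep_system \<Rightarrow> bool" where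
  "loopless M \<longleftrightarrow> (\<forall>e\<in>ground M. {e} \<in> indeps M)"

definition rank_of :: "'a indep_system \<Rightarrow> 'a set \<Rightarrow> nat" where
  "rank_of M X = Max (card ` {I \<in> indeps M. I \<subseteq> X})"

definition rk :: "'a indep_system \<Rightarrow> nat" where
  "rk M = rank_of M (ground M)"

text \<open>The lattice of flats is this set, ordered by inclusion.\<close>

definition flats :: "'a indep_system \<Rightarrow> 'a set set" where
  "flats M = {F. F \<subseteq> ground M \<and> (\<forall>e\<in>ground M - F. rank_of M F < rank_of M (insert e F))}"

definition localization :: "'a indep_system \<Rightarrow> 'a set \<Rightarrow> 'a indep_system" where
  "localization M F = \<lparr>ground = F, indeps = {I \<in> indeps M. I \<subseteq> F}\<rparr>"

definition contraction :: "'a indep_system \<Rightarrow> 'a set \<Rightarrow> 'a indep_system" where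
  "contraction M F = \<lparr>ground = ground M - F,
     indeps = {I. I \<subseteq> ground M - F \<and> rank_of M (I \<union> F) = card I + rank_of M F}\<rparr>"

section \<open>Characteristic polynomial\<close>

text \<open>
  Moebius function of a family of finite sets ordered by inclusion, for arguments in the family.
  The value on infinite sets is irrelevant and only makes the function total.
\<close>

function moebius :: "'a set set \<Rightarrow> 'a set \<Rightarrow> 'a set \<Rightarrow> int" where
  "moebius L A B =
     (if A = B then 1
      else if finite B then - (\<Sum>C\<in>{C \<in> L. A \<subseteq> C \<and> C \<subset> B}. moebius L A C)
      else 0)"
  by auto
termination
  by (relation "measure (\<lambda>(L, A, B). card B)") (auto intro: psubset_card_mono)

declare moebius.simps [simp del]

text \<open>The bottom of the lattice of flats is the intersection of all flats.\<close>

definition char_poly :: "'a indep_system \<Rightarrow> int poly" where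
  "char_poly M =
     (\<Sum>F\<in>flats M. monom (moebius (flats M) (\<Inter>(flats M)) F) (rk M - rank_of M F))"

section \<open>Kazhdan--Lusztig polynomial and Z-polynomial\<close>

text \<open>The polynomial $t^d p(t^{-1})$, for $d \ge \deg p$.\<close>

definition rev_poly :: "nat \<Rightarrow> int poly \<Rightarrow> int poly" where
  "rev_poly d p = monom 1 (d - degree p) * reflect_poly p"

definition kl_assignment :: "('a indep_system \<Rightarrow> int poly) \<Rightarrow> bool" where
  "kl_assignment P \<longleftrightarrow> (\<forall>M. matroid M \<and> loopless M \<longrightarrow>
     (rk M = 0 \<longrightarrow> P M = 1) \<and>
     (rk M > 0 \<longrightarrow> real (degree (P M)) < real (rk M) / 2) \<and>
     rev_poly (rk M) (P M) =
       (\<Sum>F\<in>flats M. char_poly (localization M F) * P (contraction M F)))"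

text \<open>
  The conditions determine an assignment on loopless matroids only; the value 0 elsewhere is a
  convention that makes the HOL function unique.
\<close>

definition kl_poly :: "'a indep_system \<Rightarrow> int poly" where
  "kl_poly = (THE P. kl_assignment P \<and> (\<forall>M. \<not> (matroid M \<and> loopless M) \<longrightarrow> P M = 0))"

definition Z_poly :: "'a indep_system \<Rightarrow> int poly" where
  "Z_poly M = (\<Sum>F\<in>flats M. monom 1 (rk (localization M F)) * kl_poly (contraction M F))"

section \<open>Graphs\<close>

text \<open>Finite simple graphs: vertices, and edges as two-element sets of vertices.\<close>

type_synonym 'v graph = "'v set \<times> 'v set set"

definition is_cycle :: "'v set set \<Rightarrow> 'v list \<Rightarrow> bool" where
  "is_cycle S vs \<longleftrightarrow> length vs \<ge> 3 \<and> distinct vs \<and>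
     (\<forall>i<length vs. {vs ! i, vs ! (Suc i mod length vs)} \<in> S)"

definition graphic_matroid :: "'v graph \<Rightarrow> 'v set indep_system" where
  "graphic_matroid G =
     \<lparr>ground = snd G, indeps = {S. S \<subseteq> snd G \<and> (\<nexists>vs. is_cycle S vs)}\<rparr>"

definition fan_graph :: "nat \<Rightarrow> nat graph" where
  "fan_graph n = ({0..n}, {{i, i + 1} | i. 1 \<le> i \<and> i < n} \<union> {{0, i} | i. 1 \<le> i \<and> i \<le> n})"

definition Z_graph :: "'v graph \<Rightarrow> int poly" where
  "Z_graph G = Z_poly (graphic_matroid G)"

section \<open>Square roots of power series\<close>

text \<open>
  The library's square root \<open>fps_radical\<close> needs coefficients in a field of characteristic 0;
  here the coefficients lie in a ring such as $\mathbb{Z}[t]$.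
\<close>

definition fps_sqrt :: "'a::{idom, ring_char_0} fps \<Rightarrow> 'a fps" where
  "fps_sqrt f = (THE s. fps_nth s 0 = 1 \<and> s ^ 2 = f)"

lemma fps_sqrt_eqI:
  assumes "fps_nth s 0 = 1" and "s ^ 2 = f"
  shows "fps_sqrt f = s"
  unfolding fps_sqrt_def
proof (rule the_equality)
  fix r assume r: "fps_nth r 0 = 1 \<and> r ^ 2 = f"
  then have "r = s \<or> r = - s"
    using assms by (metis power2_eq_iff)
  moreover have "r \<noteq> - s"
  proof
    assume "r = - s"
    then have "(1::'a) = - 1"
      using r assms(1) by (metis fps_neg_nth)
    then show False by simp
  qed
  ultimately show "r = s" by blast
qed (use assms in auto)

lemma ex_fps_sqrt:
  fixes a b :: "'a::{idom, ring_char_0} fps"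
  assumes a0: "fps_nth a 0 = 1" and b0: "fps_nth b 0 = 0"
  shows "\<exists>s. fps_nth s 0 = 1 \<and> s ^ 2 = a ^ 2 - 4 * b"
proof -
  text \<open>Solve $y = b + (1 - a) y + y^2$ coefficientwise; then $s = a - 2 y$.\<close>
  let ?P = "\<lambda>y n r. r = (if n = 0 then 0 else
              fps_nth b n + (\<Sum>i=1..<n. fps_nth (1 - a) i * y (n - i)) + (\<Sum>i=1..<n. y i * y (n - i)))"
  have "\<exists>y. \<forall>n::nat. ?P y n (y n)"
  proof (rule dependent_wellorder_choice)
    fix r :: 'a and f g :: "nat \<Rightarrow> 'a" and n :: nat
    assume eq: "\<And>m. m < n \<Longrightarrow> f m = g m"
    show "?P f n r = ?P g n r"
      using eq by (auto intro!: arg_cong2[of _ _ _ _ "(+)"] sum.cong arg_cong2[of _ _ _ _ "(*)"])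
  qed blast
  then obtain y where y: "\<And>n. ?P y n (y n)" by blast
  define Y where "Y = Abs_fps y"
  have Y0: "fps_nth Y 0 = 0" using y[of 0] by (simp add: Y_def)
  have conv: "fps_nth (c * Y) n = (\<Sum>i=1..<n. fps_nth c i * y (n - i))"
    if "fps_nth c 0 = 0" "n > 0" for c n
  proof -
    have "fps_nth (c * Y) n = (\<Sum>i=0..n. fps_nth c i * y (n - i))"
      by (simp add: fps_mult_nth Y_def)
    also have "\<dots> = (\<Sum>i=1..<n. fps_nth c i * y (n - i))"
    proof (rule sum.mono_neutral_right)
      show "\<forall>i\<in>{0..n} - {1..<n}. fps_nth c i * y (n - i) = 0"
      proof
        fix i assume "i \<in> {0..n} - {1..<n}"
        then have "i = 0 \<or> i = n" by auto
        then show "fps_nth c i * y (n - i) = 0"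
          using that(1) y[of 0] by auto
      qed
    qed auto
    finally show ?thesis .
  qed
  have Y: "Y = b + (1 - a) * Y + Y * Y"
  proof (rule fps_ext)
    fix n
    show "fps_nth Y n = fps_nth (b + (1 - a) * Y + Y * Y) n"
    proof (cases "n = 0")
      case True
      then show ?thesis using Y0 b0 by simp
    next
      case False
      then have "fps_nth (b + (1 - a) * Y + Y * Y) n =
          fps_nth b n + (\<Sum>i=1..<n. fps_nth (1 - a) i * y (n - i)) + (\<Sum>i=1..<n. y i * y (n - i))"
        using conv[of "1 - a" n] conv[of Y n] a0 Y0 by (simp add: Y_def)
      then show ?thesis using y[of n] False by (simp add: Y_def)
    qed
  qed
  have "b = a * Y - Y * Y"
    using Y by (simp add: algebra_simps)
  then have "(a - 2 * Y) ^ 2 = a ^ 2 - 4 * b"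
    by (simp only: power2_eq_square) (simp add: algebra_simps)
  moreover have "fps_nth (a - 2 * Y) 0 = 1"
    using a0 Y0 by (simp add: fps_mult_nth_0)
  ultimately show ?thesis by blast
qed

lemma fps_sqrt:
  fixes a b :: "'a::{idom, ring_char_0} fps"
  assumes "fps_nth a 0 = 1" and "fps_nth b 0 = 0"
  shows "fps_nth (fps_sqrt (a ^ 2 - 4 * b)) 0 = 1"
    and "fps_sqrt (a ^ 2 - 4 * b) ^ 2 = a ^ 2 - 4 * b"
  using ex_fps_sqrt[OF assms] fps_sqrt_eqI by blast+

end

theory Submission
  imports Defs
begin

text \<open>
  By Moebius inversion, the Kazhdan--Lusztig recursion is equivalent to the palindromicity of the
  \<open>Z\<close>-polynomials of all contractions: given the polynomials of the proper contractions, \<open>P\<close> is the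
  unique polynomial of degree less than half the rank that makes \<open>Z\<close> palindromic. To know \<open>P\<close> on all
  contractions of one matroid, it is therefore enough to guess polynomials for its flats that satisfy
  the degree bound and whose weighted sums over all upper intervals of the lattice of flats are
  palindromic.

  A flat of the fan is a word that tells for each rim vertex whether it lies in the block of the hub, in
  the block of its predecessor, or starts a new block. The contraction is, up to parallel edges, a
  union of fans glued at the hub, one for each segment between hub letters, which suggests a product
  of Motzkin-like polynomials over the segments as the guess. The sum over an upper interval,
  computed letter by letter, factors into coefficients of the power series \<open>Z\<close> with
  \<open>Z = (1 + u Z) (1 + t u Z)\<close>. These are the Narayana polynomials, which are palindromic. Solving the
  quadratic equation gives the claim.
\<close>

section \<open>Rank, contraction and localization\<close>

text \<open>\<open>kl_poly\<close> is a definite description over all loopless matroids on a type,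
  so existence and uniqueness have to be settled in general before a fan is touched. Running the
  recursion on fans alone fails: contracting a fan creates parallel edges, and comparing the result
  with smaller fans would call for invariance of P under isomorphism and simplification. Indexing
  the guess by the flats of one fixed matroid replaces this by a literal equality of iterated
  contractions. The series come from the transfer equation for words read letter by letter. A letter
  \<open>Join\<close> multiplies by t and keeps the number of open blocks, so runs of it contribute
  1/(1 - tu). Replacing u by u/(1 - tu) carries D = u(1 + D + tD^2), whose coefficients obey the
  degree bound, to N = u(1 + N)(1 + tN), and N/u is the series Z. This one substitution links the
  polynomials of small degree to the palindromic ones.\<close>

context matroid
begin

lemma finite_indep: "I \<in> indeps M \<Longrightarrow> finite I"
  using finite_ground indep_subset_ground finite_subset by blast

lemma finite_indeps: "finite (indeps M)"
  by (rule finite_subset[of _ "Pow (ground M)"]) (use finite_ground indep_subset_ground in auto)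

lemma card_le_rank: "I \<in> indeps M \<Longrightarrow> I \<subseteq> X \<Longrightarrow> card I \<le> rank_of M X"
  unfolding rank_of_def by (rule Max_ge) (use finite_indeps in auto)

lemma rank_le:
  assumes "\<And>I. I \<in> indeps M \<Longrightarrow> I \<subseteq> X \<Longrightarrow> card I \<le> k"
  shows "rank_of M X \<le> k"
  unfolding rank_of_def using finite_indeps empty_indep assms by (subst Max_le_iff) auto

lemma obtain_basis:
  obtains B where "B \<in> indeps M" "B \<subseteq> X" "card B = rank_of M X"
proof -
  have "rank_of M X \<in> card ` {I \<in> indeps M. I \<subseteq> X}"
    unfolding rank_of_def by (rule Max_in) (use finite_indeps empty_indep in auto)
  then show ?thesis using that by auto
qed

lemma extend_to_basis:
  assumes "I \<in> indeps M" "I \<subseteq> X"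
  obtains B where "B \<in> indeps M" "I \<subseteq> B" "B \<subseteq> X" "card B = rank_of M X"
proof -
  have "\<exists>B. B \<in> indeps M \<and> I \<subseteq> B \<and> B \<subseteq> X \<and> card B = rank_of M X"
    using assms
  proof (induction "rank_of M X - card I" arbitrary: I rule: less_induct)
    case less
    show ?case
    proof (cases "card I = rank_of M X")
      case True
      then show ?thesis using less.prems by blast
    next
      case False
      then have lt: "card I < rank_of M X"
        using card_le_rank[OF less.prems] by simp
      obtain J where J: "J \<in> indeps M" "J \<subseteq> X" "card J = rank_of M X"
        by (rule obtain_basis)
      then obtain x where x: "x \<in> J - I" "insert x I \<in> indeps M"
        using augment[OF less.prems(1) J(1)] lt by auto
      have "card (insert x I) = Suc (card I)"
        using x finite_indep[OF less.prems(1)] by simp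
      then have "\<exists>B. B \<in> indeps M \<and> insert x I \<subseteq> B \<and> B \<subseteq> X \<and> card B = rank_of M X"
        using less.hyps[of "insert x I"] x J less.prems lt by auto
      then show ?thesis by auto
    qed
  qed
  then show ?thesis using that by blast
qed

lemma rank_mono: "X \<subseteq> Y \<Longrightarrow> rank_of M X \<le> rank_of M Y"
  by (rule rank_le) (use card_le_rank in auto)

lemma rank_empty [simp]: "rank_of M {} = 0"
  using rank_le[of "{}" 0] by simp

lemma rank_indep: "I \<in> indeps M \<Longrightarrow> rank_of M I = card I"
  by (intro antisym rank_le card_le_rank) (auto intro: card_mono finite_indep)

lemma indep_iff_rank:
  assumes "I \<subseteq> ground M"
  shows "I \<in> indeps M \<longleftrightarrow> rank_of M I = card I"
proof
  assume eq: "rank_of M I = card I"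
  obtain B where B: "B \<in> indeps M" "B \<subseteq> I" "card B = rank_of M I"
    by (rule obtain_basis)
  then have "B = I"
    using eq assms finite_ground by (metis card_subset_eq finite_subset)
  then show "I \<in> indeps M" using B by simp
qed (rule rank_indep)

lemma rank_insert_le: "rank_of M (insert e X) \<le> Suc (rank_of M X)"
proof (rule rank_le)
  fix I assume I: "I \<in> indeps M" "I \<subseteq> insert e X"
  have "card (I - {e}) \<le> rank_of M X"
    using I indep_subset[of I "I - {e}"] by (intro card_le_rank) auto
  then show "card I \<le> Suc (rank_of M X)"
    using card_Diff1_le[of I e] finite_indep[OF I(1)] by (cases "e \<in> I") (auto simp: card_Diff_singleton)
qed

lemma card_eq_rank:
  assumes "B \<in> indeps M" "B \<subseteq> X" "\<And>e. e \<in> X - B \<Longrightarrow> insert e B \<notin> indeps M"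
  shows "rank_of M X = card B"
proof -
  obtain B' where B': "B' \<in> indeps M" "B \<subseteq> B'" "B' \<subseteq> X" "card B' = rank_of M X"
    using extend_to_basis assms by metis
  have "B' = B"
  proof (rule ccontr)
    assume "B' \<noteq> B"
    then obtain e where "e \<in> B' - B" using B' by auto
    then show False using assms(3)[of e] B' indep_subset[of B' "insert e B"] by auto
  qed
  then show ?thesis using B' by simp
qed

text \<open>Reduces the rank jump in the definition of a flat to a test on one fixed basis. If the
  rank jumps, a basis of the larger set extending \<open>B\<close> must contain \<open>e\<close>,
  since otherwise it would lie in \<open>X\<close>.\<close>

lemma rank_insert_greater_iff:
  assumes "B \<in> indeps M" "B \<subseteq> X" "card B = rank_of M X" "e \<notin> X"
  shows "rank_of M X < rank_of M (insert e X) \<longleftrightarrow> insert e B \<in> indeps M"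
proof
  assume "insert e B \<in> indeps M"
  moreover have "card (insert e B) = Suc (card B)"
    using assms finite_indep by (subst card_insert_disjoint) auto
  ultimately show "rank_of M X < rank_of M (insert e X)"
    using card_le_rank[of "insert e B" "insert e X"] insert_mono[OF assms(2)] assms(3) by simp
next
  assume lt: "rank_of M X < rank_of M (insert e X)"
  obtain J where J: "J \<in> indeps M" "B \<subseteq> J" "J \<subseteq> insert e X" "card J = rank_of M (insert e X)"
    using extend_to_basis[of B "insert e X"] assms by auto
  then have "e \<in> J"
    using card_le_rank[of J X] lt by (metis leD subset_insert)
  then show "insert e B \<in> indeps M"
    using J indep_subset[of J "insert e B"] by auto
qed

text \<open>If \<open>e\<close> were outside \<open>F\<close>, it could be added to a basis of
  \<open>F\<close> that extends \<open>I\<close>, hence also to \<open>I\<close>. This is how cycles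
  act on flats later.\<close>

lemma flat_closed:
  assumes "F \<in> flats M" "I \<in> indeps M" "I \<subseteq> F" "e \<in> ground M" "insert e I \<notin> indeps M"
  shows "e \<in> F"
proof (rule ccontr)
  assume e: "e \<notin> F"
  obtain B where B: "B \<in> indeps M" "I \<subseteq> B" "B \<subseteq> F" "card B = rank_of M F"
    using extend_to_basis assms by metis
  have "rank_of M F < rank_of M (insert e F)"
    using assms e by (auto simp: flats_def)
  then have "insert e B \<in> indeps M"
    using rank_insert_greater_iff[of B F e] B e by simp
  then show False
    using assms B indep_subset[of "insert e B" "insert e I"] by auto
qed

lemma flat_subset_ground: "F \<in> flats M \<Longrightarrow> F \<subseteq> ground M"
  by (simp add: flats_def)

lemma finite_flats: "finite (flats M)"
  by (rule finite_subset[of _ "Pow (ground M)"]) (use finite_ground flat_subset_ground in auto)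

lemma finite_flat: "F \<in> flats M \<Longrightarrow> finite F"
  using finite_subset flat_subset_ground finite_ground by blast

lemma ground_flat: "ground M \<in> flats M"
  by (simp add: flats_def)

lemma empty_flat:
  assumes "loopless M"
  shows "{} \<in> flats M"
proof -
  have "0 < rank_of M {e}" if "e \<in> ground M" for e
    using card_le_rank[of "{e}" "{e}"] that assms by (simp add: loopless_def)
  then show ?thesis by (auto simp: flats_def)
qed

lemma rank_le_rk: "F \<subseteq> ground M \<Longrightarrow> rank_of M F \<le> rk M"
  by (simp add: rk_def rank_mono)

lemma flat_rank_strict_mono:
  assumes "F \<in> flats M" "F \<subset> G" "G \<subseteq> ground M"
  shows "rank_of M F < rank_of M G"
proof -
  obtain e where e: "e \<in> G - F" using assms by blast
  then have "rank_of M F < rank_of M (insert e F)"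
    using assms by (auto simp: flats_def)
  also have "\<dots> \<le> rank_of M G"
    using e assms by (intro rank_mono) auto
  finally show ?thesis .
qed

lemma flat_eq_ground_iff: "F \<in> flats M \<Longrightarrow> rank_of M F = rk M \<longleftrightarrow> F = ground M"
  using flat_rank_strict_mono[of F "ground M"] flat_subset_ground[of F]
  by (metis less_irrefl order_refl psubsetI rk_def)

lemma flats_eq_empty_of_rk_0: "loopless M \<Longrightarrow> rk M = 0 \<Longrightarrow> flats M = {{}}"
  using flat_eq_ground_iff rank_le_rk flat_subset_ground empty_flat by fastforce

section \<open>Contraction: matroid axioms, rank, flats and iteration\<close>

lemma ground_contraction [simp]: "ground (contraction M F) = ground M - F"
  by (simp add: contraction_def)

lemma contraction_empty: "contraction M {} = M"
proof -
  have "{I. I \<subseteq> ground M \<and> rank_of M I = card I} = indeps M"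
    using indep_iff_rank indep_subset_ground by auto
  then show ?thesis by (simp add: contraction_def)
qed

lemma basis_Int:
  assumes "B \<in> indeps M" "B \<subseteq> F" "card B = rank_of M F" "B \<subseteq> J" "J \<in> indeps M"
  shows "J \<inter> F = B"
proof -
  have "card (J \<inter> F) \<le> rank_of M F"
    using assms by (intro card_le_rank) (auto intro: indep_subset)
  then show ?thesis
    using assms finite_indep[of J] by (metis card_seteq finite_Int inf.boundedI)
qed

text \<open>With a basis \<open>B\<close> of \<open>F\<close> fixed, independence in the contraction
  becomes independence in \<open>M\<close> after adding \<open>B\<close>; the matroid axioms can
  then be pulled back along this union.\<close>

lemma indeps_contraction:
  assumes F: "F \<subseteq> ground M" and B: "B \<in> indeps M" "B \<subseteq> F" "card B = rank_of M F"
  shows "indeps (contraction M F) = {I. I \<subseteq> ground M - F \<and> I \<union> B \<in> indeps M}"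
proof -
  have "rank_of M (I \<union> F) = card I + rank_of M F \<longleftrightarrow> I \<union> B \<in> indeps M"
    if I: "I \<subseteq> ground M - F" for I
  proof -
    have fin: "finite I" "finite B" using I finite_ground finite_subset finite_indep[OF B(1)] by auto
    have card: "card (I \<union> B) = card I + rank_of M F"
      using B I fin by (subst card_Un_disjoint) auto
    show ?thesis
    proof
      assume eq: "rank_of M (I \<union> F) = card I + rank_of M F"
      obtain J where J: "J \<in> indeps M" "B \<subseteq> J" "J \<subseteq> I \<union> F" "card J = rank_of M (I \<union> F)"
        using extend_to_basis[of B "I \<union> F"] B by auto
      then have "J \<subseteq> I \<union> B"
        using basis_Int[OF B J(2,1)] by blast
      then have "J = I \<union> B"
        using card J eq fin by (metis card_subset_eq finite_UnI)
      then show "I \<union> B \<in> indeps M" using J by simp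
    next
      assume ind: "I \<union> B \<in> indeps M"
      then obtain J where J: "J \<in> indeps M" "I \<union> B \<subseteq> J" "J \<subseteq> I \<union> F" "card J = rank_of M (I \<union> F)"
        using extend_to_basis[of "I \<union> B" "I \<union> F"] B by auto
      then have "J = I \<union> B"
        using basis_Int[OF B, of J] by blast
      then show "rank_of M (I \<union> F) = card I + rank_of M F"
        using card J by simp
    qed
  qed
  then show ?thesis by (auto simp: contraction_def)
qed

lemma matroid_contraction:
  assumes F: "F \<subseteq> ground M"
  shows "matroid (contraction M F)"
proof -
  obtain B where B: "B \<in> indeps M" "B \<subseteq> F" "card B = rank_of M F"
    by (rule obtain_basis)
  note ind = indeps_contraction[OF F B]
  have aug: "\<exists>x\<in>J - I. insert x I \<in> indeps (contraction M F)"
    if "I \<in> indeps (contraction M F)" "J \<in> indeps (contraction M F)" "card I < card J" for I J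
  proof -
    have IJ: "I \<subseteq> ground M - F" "I \<union> B \<in> indeps M" "J \<subseteq> ground M - F" "J \<union> B \<in> indeps M"
      using that ind by auto
    then have fin: "finite I" "finite J" "finite B"
      using finite_indep[of "I \<union> B"] finite_indep[of "J \<union> B"] by auto
    have "card (I \<union> B) = card I + card B" "card (J \<union> B) = card J + card B"
      using card_Un_disjoint[of I B] card_Un_disjoint[of J B] IJ B(2) fin by blast+
    then have "card (I \<union> B) < card (J \<union> B)"
      using that by simp
    then obtain x where "x \<in> (J \<union> B) - (I \<union> B)" "insert x (I \<union> B) \<in> indeps M"
      using augment[OF IJ(2,4)] by blast
    then show ?thesis using IJ ind by (intro bexI[of _ x]) auto
  qed
  show ?thesis
  proof
    show "finite (ground (contraction M F))" using finite_ground by simp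
  next
    fix I J assume "I \<in> indeps (contraction M F)" "J \<subseteq> I"
    then show "J \<in> indeps (contraction M F)"
      unfolding ind using indep_subset[of "I \<union> B" "J \<union> B"] by auto
  qed (use aug ind B in auto)
qed

text \<open>The additive form avoids truncated subtraction. A basis of the contraction grows by
  \<open>B\<close>; conversely a basis of the union that contains \<open>B\<close> meets
  \<open>F\<close> exactly in \<open>B\<close>.\<close>

lemma rank_contraction:
  assumes F: "F \<subseteq> ground M" and X: "X \<subseteq> ground M - F"
  shows "rank_of (contraction M F) X + rank_of M F = rank_of M (X \<union> F)"
proof (rule antisym)
  obtain B where B: "B \<in> indeps M" "B \<subseteq> F" "card B = rank_of M F"
    by (rule obtain_basis)
  note ind = indeps_contraction[OF F B]
  interpret N: matroid "contraction M F" by (rule matroid_contraction[OF F])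
  have card: "card (I \<union> B) = card I + rank_of M F" if "I \<subseteq> X" for I
    using that X B finite_indep[OF B(1)] finite_subset[OF that] finite_subset[OF X] finite_ground
    by (subst card_Un_disjoint) auto
  obtain I where I: "I \<in> indeps (contraction M F)" "I \<subseteq> X" "card I = rank_of (contraction M F) X"
    by (rule N.obtain_basis)
  then show "rank_of (contraction M F) X + rank_of M F \<le> rank_of M (X \<union> F)"
    using card_le_rank[of "I \<union> B" "X \<union> F"] card[of I] B ind by auto
  obtain J where J: "J \<in> indeps M" "B \<subseteq> J" "J \<subseteq> X \<union> F" "card J = rank_of M (X \<union> F)"
    using extend_to_basis[of B "X \<union> F"] B by auto
  then have JF: "J \<inter> F = B"
    using basis_Int[OF B, of J] by blast
  then have sub: "J - F \<subseteq> X" "J - F \<union> B = J"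
    using J by auto
  then have "J - F \<in> indeps (contraction M F)"
    unfolding ind using X J by auto
  then have "card (J - F) \<le> rank_of (contraction M F) X"
    using sub by (intro N.card_le_rank) auto
  then show "rank_of M (X \<union> F) \<le> rank_of (contraction M F) X + rank_of M F"
    using card[OF sub(1)] sub J by simp
qed

lemma rank_contraction_flat:
  assumes "F \<subseteq> G" "G \<subseteq> ground M"
  shows "rank_of (contraction M F) (G - F) = rank_of M G - rank_of M F"
  using rank_contraction[of F "G - F"] assms by (simp add: Un_absorb2 subset_trans Diff_mono)

lemma rk_contraction:
  "F \<subseteq> ground M \<Longrightarrow> rk (contraction M F) = rk M - rank_of M F"
  using rank_contraction_flat[of F "ground M"] by (simp add: rk_def)

lemma loopless_contraction:
  assumes "F \<in> flats M"
  shows "loopless (contraction M F)"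
  unfolding loopless_def
proof
  fix e assume e: "e \<in> ground (contraction M F)"
  then have "rank_of M F < rank_of M (insert e F)"
    using assms by (auto simp: flats_def)
  then have "rank_of M (insert e F) = Suc (rank_of M F)"
    using rank_insert_le[of e F] by simp
  then show "{e} \<in> indeps (contraction M F)"
    using e by (simp add: contraction_def)
qed

lemma flats_contraction:
  assumes F: "F \<subseteq> ground M"
  shows "flats (contraction M F) = (\<lambda>G. G - F) ` {G \<in> flats M. F \<subseteq> G}"
proof -
  have iff: "X \<in> flats (contraction M F) \<longleftrightarrow> X \<union> F \<in> flats M" if X: "X \<subseteq> ground M - F" for X
  proof -
    have "rank_of (contraction M F) X < rank_of (contraction M F) (insert e X) \<longleftrightarrow>
        rank_of M (X \<union> F) < rank_of M (insert e (X \<union> F))" if "e \<in> ground M - F - X" for e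
      using rank_contraction[OF F X] rank_contraction[OF F, of "insert e X"] X that by auto
    moreover have "ground M - (X \<union> F) = ground M - F - X" by auto
    ultimately show ?thesis using X F by (auto simp: flats_def)
  qed
  show ?thesis
  proof (intro equalityI subsetI)
    fix X assume X: "X \<in> flats (contraction M F)"
    then have "X \<subseteq> ground M - F" by (auto simp: flats_def)
    then show "X \<in> (\<lambda>G. G - F) ` {G \<in> flats M. F \<subseteq> G}"
      using iff[of X] X by (intro image_eqI[of _ _ "X \<union> F"]) auto
  next
    fix X assume "X \<in> (\<lambda>G. G - F) ` {G \<in> flats M. F \<subseteq> G}"
    then obtain G where G: "X = G - F" "G \<in> flats M" "F \<subseteq> G" by auto
    then have "X \<union> F = G" by auto
    then show "X \<in> flats (contraction M F)"
      using iff[of X] G flat_subset_ground by blast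
  qed
qed

text \<open>An equality of records, not merely an isomorphism: the ground sets coincide and the two
  rank functions differ by a constant.\<close>

lemma contraction_contraction:
  assumes "F \<subseteq> G" "G \<subseteq> ground M"
  shows "contraction (contraction M F) (G - F) = contraction M G"
proof -
  have ground: "ground M - F - (G - F) = ground M - G" using assms by auto
  have "rank_of (contraction M F) (I \<union> (G - F)) = card I + rank_of (contraction M F) (G - F) \<longleftrightarrow>
      rank_of M (I \<union> G) = card I + rank_of M G" if "I \<subseteq> ground M - G" for I
  proof -
    have eq: "I \<union> (G - F) \<union> F = I \<union> G" "G - F \<union> F = G" using assms by auto
    have "F \<subseteq> ground M" "G - F \<subseteq> ground M - F" "I \<union> (G - F) \<subseteq> ground M - F"
      using assms that by auto
    then show ?thesis
      using rank_contraction[of F "I \<union> (G - F)", unfolded eq]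
        rank_contraction[of F "G - F", unfolded eq] by auto
  qed
  then show ?thesis
    unfolding contraction_def[of "contraction M F"] contraction_def[of M G]
    by (simp add: ground) blast
qed

lemma sum_flats_contraction:
  assumes "F \<subseteq> ground M"
  shows "(\<Sum>G\<in>flats (contraction M F). f G) = (\<Sum>G | G \<in> flats M \<and> F \<subseteq> G. f (G - F))"
  unfolding flats_contraction[OF assms]
  by (subst sum.reindex) (auto simp: inj_on_def)

section \<open>Localization at a flat\<close>

lemma rank_localization: "X \<subseteq> F \<Longrightarrow> rank_of (localization M F) X = rank_of M X"
  unfolding rank_of_def localization_def
  by (rule arg_cong[where f = "\<lambda>A. Max (card ` A)"]) auto

lemma rk_localization: "rk (localization M F) = rank_of M F"
proof -
  have "ground (localization M F) = F" by (simp add: localization_def)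
  then show ?thesis by (simp add: rk_def rank_localization)
qed

text \<open>Elements outside the flat \<open>F\<close> raise the rank of every subset of
  \<open>F\<close>, so only the elements of \<open>F\<close> itself have to be tested.\<close>

lemma flats_localization:
  assumes F: "F \<in> flats M"
  shows "flats (localization M F) = {G \<in> flats M. G \<subseteq> F}"
proof -
  have ground: "ground (localization M F) = F" by (simp add: localization_def)
  have "rank_of M G < rank_of M (insert e G)" if "G \<subseteq> F" "e \<in> ground M - F" for G e
  proof -
    obtain B where B: "B \<in> indeps M" "B \<subseteq> G" "card B = rank_of M G"
      by (rule obtain_basis)
    then have "insert e B \<in> indeps M"
      using flat_closed[OF F, of B e] that by auto
    then show ?thesis
      using rank_insert_greater_iff[of B G e] B that by auto
  qed
  then have "(\<forall>e\<in>F - G. rank_of M G < rank_of M (insert e G)) \<longleftrightarrow> G \<in> flats M" if "G \<subseteq> F" for G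
    using that flat_subset_ground[OF F] unfolding flats_def by blast
  then show ?thesis
    unfolding flats_def[of "localization M F"] ground
    by (smt (verit) Collect_cong DiffD1 insert_subset rank_localization)
qed

end

section \<open>Palindromic polynomials\<close>

lemma coeff_rev_poly:
  "degree p \<le> d \<Longrightarrow> coeff (rev_poly d p) i = (if i \<le> d then coeff p (d - i) else 0)"
  unfolding rev_poly_def coeff_monom_mult coeff_reflect_poly
  by (auto intro: coeff_eq_0 arg_cong[where f = "coeff p"])

lemma rev_poly_sum:
  assumes "\<And>x. x \<in> A \<Longrightarrow> degree (f x) \<le> d"
  shows "rev_poly d (\<Sum>x\<in>A. f x) = (\<Sum>x\<in>A. rev_poly d (f x))"
proof (cases "finite A")
  case True
  then have "degree (\<Sum>x\<in>A. f x) \<le> d" using assms by (intro degree_sum_le)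
  then show ?thesis
    using assms by (intro poly_eqI) (simp add: coeff_sum coeff_rev_poly)
qed (simp add: rev_poly_def)

lemma degree_monom_mult_le:
  fixes p :: "int poly"
  shows "degree p \<le> d - k \<Longrightarrow> k \<le> d \<Longrightarrow> degree (monom 1 k * p) \<le> d"
  using degree_mult_le[of "monom 1 k" p] by (simp add: degree_monom_eq)

lemma rev_poly_monom_mult:
  assumes "degree p \<le> d - k" "k \<le> d"
  shows "rev_poly d (monom 1 k * p) = rev_poly (d - k) p"
  using assms degree_monom_mult_le[OF assms]
  by (intro poly_eqI) (auto simp: coeff_rev_poly coeff_monom_mult add.commute intro: arg_cong[where f = "coeff p"])

definition palindromic :: "nat \<Rightarrow> int poly \<Rightarrow> bool" where
  "palindromic d p \<longleftrightarrow> degree p \<le> d \<and> rev_poly d p = p"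

lemma palindromic_iff_coeff:
  "palindromic d p \<longleftrightarrow> degree p \<le> d \<and> (\<forall>i\<le>d. coeff p (d - i) = coeff p i)"
  by (auto simp: palindromic_def poly_eq_iff coeff_rev_poly coeff_eq_0) metis

lemma palindromic_0 [simp]: "palindromic d 0"
  by (simp add: palindromic_iff_coeff)

lemma palindromic_add: "palindromic d p \<Longrightarrow> palindromic d q \<Longrightarrow> palindromic d (p + q)"
  by (auto simp: palindromic_iff_coeff intro: degree_add_le)

lemma palindromic_sum:
  "(\<And>x. x \<in> A \<Longrightarrow> palindromic d (f x)) \<Longrightarrow> palindromic d (\<Sum>x\<in>A. f x)"
  by (induction A rule: infinite_finite_induct) (auto intro: palindromic_add)

text \<open>Reversal is multiplicative because degrees add over a domain. Zero factors are treated
  apart since degree additivity fails for them.\<close>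

lemma palindromic_mult:
  assumes "palindromic d p" "palindromic e q"
  shows "palindromic (d + e) (p * q)"
proof (cases "p = 0 \<or> q = 0")
  case False
  have "rev_poly (d + e) (p * q) = rev_poly d p * rev_poly e q"
  proof -
    have "d + e - (degree p + degree q) = (d - degree p) + (e - degree q)"
      using assms by (simp add: palindromic_def)
    moreover have "monom 1 (m + n) = monom 1 m * (monom 1 n :: int poly)" for m n
      by (simp add: mult_monom)
    ultimately show ?thesis
      using False by (simp add: rev_poly_def degree_mult_eq reflect_poly_mult)
  qed
  then show ?thesis
    using assms False by (simp add: palindromic_def degree_mult_eq)
qed (auto simp: palindromic_def rev_poly_def)

text \<open>
  The unique polynomial \<open>P\<close> of degree less than \<open>r / 2\<close> such that \<open>P + Q\<close> is palindromic of degree \<open>r\<close>,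
  for \<open>r > 0\<close> and \<open>degree Q \<le> r\<close>.
\<close>

definition palindromic_completion :: "nat \<Rightarrow> int poly \<Rightarrow> int poly" where
  "palindromic_completion r Q = (\<Sum>i | 2 * i < r. monom (coeff Q (r - i) - coeff Q i) i)"

lemma coeff_palindromic_completion:
  "coeff (palindromic_completion r Q) i = (if 2 * i < r then coeff Q (r - i) - coeff Q i else 0)"
proof -
  have "finite {i. 2 * i < r}" by (rule finite_subset[of _ "{..<r}"]) auto
  then show ?thesis
    by (simp add: palindromic_completion_def coeff_sum sum.delta)
qed

lemma degree_palindromic_completion:
  assumes "r > 0"
  shows "2 * degree (palindromic_completion r Q) < r"
proof -
  \<comment> \<open>The bound is the largest \<open>i\<close> with \<open>2 * i < r\<close>.\<close>
  have "degree (palindromic_completion r Q) \<le> (r - 1) div 2"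
    by (rule degree_le) (auto simp: coeff_palindromic_completion)
  then show ?thesis using assms by linarith
qed

lemma palindromic_palindromic_completion:
  assumes "degree Q \<le> r"
  shows "palindromic r (palindromic_completion r Q + Q)"
  unfolding palindromic_iff_coeff
proof (intro conjI allI impI)
  have "degree (palindromic_completion r Q) \<le> r"
    by (rule degree_le) (auto simp: coeff_palindromic_completion)
  then show "degree (palindromic_completion r Q + Q) \<le> r"
    using assms by (rule degree_add_le)
qed (auto simp: coeff_palindromic_completion intro: arg_cong[where f = "coeff Q"])

text \<open>For \<open>2 * i < r\<close> the mirror coefficient of \<open>P\<close> at
  \<open>r - i\<close> vanishes, so the symmetry of the sum expresses \<open>coeff P i\<close>
  through \<open>Q\<close>.\<close>

lemma palindromic_completion_unique:
  assumes "2 * degree P < r" "palindromic r (P + Q)"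
  shows "P = palindromic_completion r Q"
proof (rule poly_eqI)
  fix i
  show "coeff P i = coeff (palindromic_completion r Q) i"
  proof (cases "2 * i < r")
    case True
    then have "coeff (P + Q) (r - i) = coeff (P + Q) i"
      using assms by (simp add: palindromic_iff_coeff)
    moreover have "coeff P (r - i) = 0"
      using True assms by (intro coeff_eq_0) linarith
    ultimately show ?thesis using True by (simp add: coeff_palindromic_completion)
  next
    case False
    then have "coeff P i = 0" using assms by (intro coeff_eq_0) linarith
    then show ?thesis using False by (simp add: coeff_palindromic_completion)
  qed
qed

section \<open>Existence and uniqueness of Kazhdan--Lusztig polynomials\<close>

text \<open>The empty flat is left out because its term is the unknown polynomial itself; every
  other flat shrinks the ground set. Rank 0 needs its own clause, as the completion for
  \<open>r = 0\<close> is 0. The value 0 elsewhere matches the convention in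
  \<open>kl_poly\<close>.\<close>

function kl_rec :: "'a indep_system \<Rightarrow> int poly" where
  "kl_rec M =
     (if matroid M \<and> loopless M then
        if rk M = 0 then 1
        else palindromic_completion (rk M)
          (\<Sum>F\<in>flats M - {{}}. monom 1 (rank_of M F) * kl_rec (contraction M F))
      else 0)"
  by auto
termination
proof (relation "measure (\<lambda>M. card (ground M))", goal_cases)
  case (2 M F)
  then interpret matroid M by simp
  have "F \<noteq> {}" "F \<subseteq> ground M" using 2 flat_subset_ground by auto
  then show ?case
    using finite_ground by (auto intro!: psubset_card_mono)
qed simp

declare kl_rec.simps [simp del]

section \<open>Moebius inversion and the defining recursion\<close>

lemma moebius_lower_set:
  assumes "B \<subseteq> F"
  shows "moebius {C \<in> L. C \<subseteq> F} A B = moebius L A B"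
proof (cases "finite B")
  case True
  then show ?thesis using assms
  proof (induction B rule: finite_psubset_induct)
    case (psubset B)
    have "{C \<in> {C \<in> L. C \<subseteq> F}. A \<subseteq> C \<and> C \<subset> B} = {C \<in> L. A \<subseteq> C \<and> C \<subset> B}"
      using psubset.prems by auto
    moreover have "(\<Sum>C | C \<in> L \<and> A \<subseteq> C \<and> C \<subset> B. moebius {C \<in> L. C \<subseteq> F} A C) =
        (\<Sum>C | C \<in> L \<and> A \<subseteq> C \<and> C \<subset> B. moebius L A C)"
      using psubset by (intro sum.cong) auto
    ultimately show ?case
      using psubset.hyps by (simp add: moebius.simps[of _ A B])
  qed
qed (simp add: moebius.simps[of _ A B])

lemma sum_moebius_lower_set:
  assumes "{} \<in> L" "finite L" "F \<in> L" "finite F"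
  shows "(\<Sum>G | G \<in> L \<and> G \<subseteq> F. moebius L {} G) = (if F = {} then 1 else 0)"
proof (cases "F = {}")
  case True
  then have "{G. G \<in> L \<and> G \<subseteq> F} = {{}}" using assms by auto
  then show ?thesis using True by (simp add: moebius.simps)
next
  case False
  have "{G. G \<in> L \<and> G \<subseteq> F} = insert F {G \<in> L. {} \<subseteq> G \<and> G \<subset> F}" using assms by auto
  then show ?thesis
    using False assms by (simp add: moebius.simps[of L "{}" F])
qed

context
  fixes M :: "'a indep_system"
  assumes M: "matroid M" "loopless M"
begin

interpretation matroid M by (rule M)

lemma degree_kl_rec: "rk M > 0 \<Longrightarrow> 2 * degree (kl_rec M) < rk M"
  using M by (simp add: kl_rec.simps[of M] degree_palindromic_completion)

lemma kl_rec_rk_0: "rk M = 0 \<Longrightarrow> kl_rec M = 1"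
  using M by (simp add: kl_rec.simps)

lemma degree_kl_rec_le: "degree (kl_rec M) \<le> rk M"
  using degree_kl_rec kl_rec_rk_0 by (cases "rk M = 0") auto

end

lemma degree_kl_rec_contraction_le:
  assumes "matroid M" "F \<in> flats M"
  shows "degree (kl_rec (contraction M F)) \<le> rk M - rank_of M F"
  using degree_kl_rec_le[of "contraction M F"] assms
  by (simp add: matroid.rk_contraction matroid.flat_subset_ground matroid.matroid_contraction
      matroid.loopless_contraction)

text \<open>The term of the empty flat is \<open>kl_rec M\<close>, and the completion was chosen to
  make the total palindromic; in rank 0 the empty flat is the only one.\<close>

lemma palindromic_kl_rec_sum:
  assumes M: "matroid M" "loopless M"
  shows "palindromic (rk M) (\<Sum>F\<in>flats M. monom 1 (rank_of M F) * kl_rec (contraction M F))"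
proof -
  interpret matroid M by (rule M)
  define Q where "Q = (\<Sum>F\<in>flats M - {{}}. monom 1 (rank_of M F) * kl_rec (contraction M F))"
  have sum: "(\<Sum>F\<in>flats M. monom 1 (rank_of M F) * kl_rec (contraction M F)) = kl_rec M + Q"
    unfolding Q_def using finite_flats empty_flat[OF M(2)]
    by (simp add: sum.remove contraction_empty)
  show ?thesis
  proof (cases "rk M = 0")
    case True
    then have "Q = 0" unfolding Q_def using flats_eq_empty_of_rk_0[OF M(2)] by simp
    then show ?thesis
      unfolding sum using True kl_rec_rk_0[OF M] by (simp add: palindromic_iff_coeff)
  next
    case False
    have "degree Q \<le> rk M" unfolding Q_def
      using degree_kl_rec_contraction_le[OF M(1)] rank_le_rk flat_subset_ground finite_flats
      by (intro degree_sum_le degree_monom_mult_le) auto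
    then show ?thesis
      unfolding sum
      using palindromic_palindromic_completion[of Q "rk M"] M False
      by (simp add: kl_rec.simps[of M] Q_def)
  qed
qed

text \<open>Moves sums over flats of a contraction into an upper interval of \<open>M\<close>, so
  that all sums range over flats of one matroid.\<close>

lemma (in matroid) upper_sum_eq:
  assumes G: "G \<in> flats M"
  shows "(\<Sum>F\<in>flats (contraction M G). monom 1 (rank_of (contraction M G) F) * f (contraction (contraction M G) F))
       = (\<Sum>F | F \<in> flats M \<and> G \<subseteq> F. monom 1 (rank_of M F - rank_of M G) * f (contraction M F))"
  using G by (subst sum_flats_contraction)
    (auto intro!: sum.cong simp: flat_subset_ground contraction_contraction rank_contraction_flat)

lemma palindromic_kl_rec_upper_sum:
  assumes M: "matroid M" and G: "G \<in> flats M"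
  shows "palindromic (rk M - rank_of M G)
    (\<Sum>F | F \<in> flats M \<and> G \<subseteq> F. monom 1 (rank_of M F - rank_of M G) * kl_rec (contraction M F))"
proof -
  interpret matroid M by (rule M)
  show ?thesis
    using palindromic_kl_rec_sum[OF matroid_contraction loopless_contraction, of G] G M
    by (simp add: upper_sum_eq[OF G, of kl_rec] rk_contraction flat_subset_ground)
qed

lemma char_poly_localization:
  assumes M: "matroid M" "loopless M" and F: "F \<in> flats M"
  shows "char_poly (localization M F) =
    (\<Sum>G | G \<in> flats M \<and> G \<subseteq> F. monom (moebius (flats M) {} G) (rank_of M F - rank_of M G))"
proof -
  interpret matroid M by (rule M)
  have "\<Inter> {G \<in> flats M. G \<subseteq> F} = {}" using empty_flat[OF M(2)] by auto
  then show ?thesis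
    unfolding char_poly_def flats_localization[OF F] rk_localization
    by (auto intro!: sum.cong simp: moebius_lower_set rank_localization)
qed

text \<open>
  The palindromicity of the \<open>Z\<close>-polynomials of all contractions, \<open>\<Sum>\<^bsub>F \<supseteq> G\<^esub> rev (P (M / F)) = Z (M / G)\<close>,
  is turned into the defining recursion by Moebius inversion over \<open>G\<close>.
\<close>

lemma rev_poly_kl_rec:
  assumes M: "matroid M" "loopless M"
  shows "rev_poly (rk M) (kl_rec M) =
    (\<Sum>F\<in>flats M. char_poly (localization M F) * kl_rec (contraction M F))"
proof -
  interpret matroid M by (rule M)
  let ?f = "\<lambda>F. kl_rec (contraction M F)"
  let ?X = "\<lambda>F. rev_poly (rk M - rank_of M F) (?f F)"
  let ?mu = "moebius (flats M) {}"
  have upper: "(\<Sum>F | F \<in> flats M \<and> G \<subseteq> F. ?X F) =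
      (\<Sum>F | F \<in> flats M \<and> G \<subseteq> F. monom 1 (rank_of M F - rank_of M G) * ?f F)" (is "_ = ?Z")
    if G: "G \<in> flats M" for G
  proof -
    have le: "rank_of M G \<le> rank_of M F" "rank_of M F \<le> rk M" if "F \<in> flats M" "G \<subseteq> F" for F
      using that rank_mono rank_le_rk flat_subset_ground by auto
    have deg: "degree (?f F) \<le> rk M - rank_of M G - (rank_of M F - rank_of M G)"
      if "F \<in> flats M" "G \<subseteq> F" for F
      using degree_kl_rec_contraction_le[OF M(1) that(1)] le[OF that] by simp
    have "?Z = rev_poly (rk M - rank_of M G) ?Z"
      using palindromic_kl_rec_upper_sum[OF M(1) G] by (simp add: palindromic_def)
    also have "\<dots> = (\<Sum>F | F \<in> flats M \<and> G \<subseteq> F.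
        rev_poly (rk M - rank_of M G) (monom 1 (rank_of M F - rank_of M G) * ?f F))"
      using deg le by (intro rev_poly_sum degree_monom_mult_le) (auto simp: diff_le_mono)
    also have "\<dots> = (\<Sum>F | F \<in> flats M \<and> G \<subseteq> F. ?X F)"
    proof (rule sum.cong)
      fix F assume "F \<in> {F. F \<in> flats M \<and> G \<subseteq> F}"
      then show "rev_poly (rk M - rank_of M G) (monom 1 (rank_of M F - rank_of M G) * ?f F) = ?X F"
        using deg[of F] le[of F] by (subst rev_poly_monom_mult) auto
    qed simp
    finally show ?thesis by simp
  qed
  \<comment> \<open>The indicator of the empty flat is kept as an integer because the next step
    expands it into a sum of Moebius values.\<close>
  have "?X {} = (\<Sum>F\<in>flats M. of_int (if F = {} then 1 else 0) * ?X F)"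
  proof -
    have "(\<Sum>F\<in>flats M. of_int (if F = {} then 1 else 0) * ?X F) = (\<Sum>F\<in>flats M. if F = {} then ?X F else 0)"
      by (rule sum.cong) auto
    then show ?thesis using empty_flat[OF M(2)] finite_flats by simp
  qed
  also have "\<dots> = (\<Sum>F\<in>flats M. \<Sum>G | G \<in> flats M \<and> G \<subseteq> F. of_int (?mu G) * ?X F)"
  proof (rule sum.cong)
    fix F assume "F \<in> flats M"
    then have "(\<Sum>G | G \<in> flats M \<and> G \<subseteq> F. ?mu G) = (if F = {} then 1 else 0)"
      using empty_flat[OF M(2)] finite_flats finite_flat by (intro sum_moebius_lower_set)
    then have "of_int (if F = {} then 1 else 0) * ?X F =
        of_int (\<Sum>G | G \<in> flats M \<and> G \<subseteq> F. ?mu G) * ?X F"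
      by simp
    then show "of_int (if F = {} then 1 else 0) * ?X F =
        (\<Sum>G | G \<in> flats M \<and> G \<subseteq> F. of_int (?mu G) * ?X F)"
      by (simp only: of_int_sum sum_distrib_right)
  qed simp
  \<comment> \<open>The exchange exposes a sum over an upper interval, where palindromicity applies;
    exchanging back collects the characteristic polynomials of the localizations.\<close>
  also have "\<dots> = (\<Sum>G\<in>flats M. \<Sum>F | F \<in> flats M \<and> G \<subseteq> F. of_int (?mu G) * ?X F)"
    by (rule sum.swap_restrict) (rule finite_flats)+
  also have "\<dots> = (\<Sum>G\<in>flats M. \<Sum>F | F \<in> flats M \<and> G \<subseteq> F.
      of_int (?mu G) * (monom 1 (rank_of M F - rank_of M G) * ?f F))"
    by (simp add: sum_distrib_left[symmetric] upper)
  also have "\<dots> = (\<Sum>F\<in>flats M. \<Sum>G | G \<in> flats M \<and> G \<subseteq> F.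
      of_int (?mu G) * (monom 1 (rank_of M F - rank_of M G) * ?f F))"
    by (rule sum.swap_restrict[symmetric]) (rule finite_flats)+
  also have "\<dots> = (\<Sum>F\<in>flats M. char_poly (localization M F) * ?f F)"
  proof (rule sum.cong)
    fix F assume F: "F \<in> flats M"
    show "(\<Sum>G | G \<in> flats M \<and> G \<subseteq> F. of_int (?mu G) * (monom 1 (rank_of M F - rank_of M G) * ?f F))
        = char_poly (localization M F) * ?f F"
      unfolding char_poly_localization[OF M F] sum_distrib_right
      by (rule sum.cong) (simp_all add: of_int_poly smult_monom mult.assoc[symmetric])
  qed simp
  finally show ?thesis by (simp add: contraction_empty)
qed

lemma kl_assignment_kl_rec: "kl_assignment kl_rec"
  unfolding kl_assignment_def
proof (intro allI impI conjI)
  fix M :: "'a indep_system"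
  assume M: "matroid M \<and> loopless M"
  show "real (degree (kl_rec M)) < real (rk M) / 2" if "rk M > 0"
    using degree_kl_rec[of M] M that by linarith
qed (auto simp: kl_rec_rk_0 rev_poly_kl_rec)

text \<open>The empty flat contributes \<open>P M\<close> with coefficient 1 and all other
  contractions are smaller. Hence \<open>rev_poly (rk M) (P M) - P M\<close> is determined, and by
  the degree bound its two parts occupy disjoint ranges of exponents.\<close>

lemma kl_assignment_unique:
  assumes P: "kl_assignment P" and P': "kl_assignment P'" and M: "matroid M" "loopless M"
  shows "P M = P' M"
  using M
proof (induction "card (ground M)" arbitrary: M rule: less_induct)
  case less
  interpret matroid M by (rule less.prems)
  note kl = P[unfolded kl_assignment_def, rule_format, of M]
    P'[unfolded kl_assignment_def, rule_format, of M]
  show ?case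
  proof (cases "rk M = 0")
    case False
    have deg: "2 * degree (P M) < rk M" "2 * degree (P' M) < rk M"
      using kl less.prems False by auto
    have split: "(\<Sum>F\<in>flats M. char_poly (localization M F) * R (contraction M F)) =
        R M + (\<Sum>F\<in>flats M - {{}}. char_poly (localization M F) * R (contraction M F))" for R :: "_ \<Rightarrow> int poly"
    proof -
      have "{G. G \<in> flats M \<and> G \<subseteq> {}} = {{}}" using empty_flat[OF less.prems(2)] by auto
      then have "char_poly (localization M {}) = 1"
        using less.prems by (simp add: char_poly_localization empty_flat moebius.simps)
      then show ?thesis
        using finite_flats empty_flat[OF less.prems(2)] by (simp add: sum.remove contraction_empty)
    qed
    have "(\<Sum>F\<in>flats M - {{}}. char_poly (localization M F) * P (contraction M F)) =
        (\<Sum>F\<in>flats M - {{}}. char_poly (localization M F) * P' (contraction M F))"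
    proof (rule sum.cong)
      fix F assume F: "F \<in> flats M - {{}}"
      then have "card (ground (contraction M F)) < card (ground M)"
        using flat_subset_ground finite_ground by (auto intro!: psubset_card_mono)
      then have "P (contraction M F) = P' (contraction M F)"
        using F by (intro less.hyps matroid_contraction loopless_contraction flat_subset_ground) auto
      then show "char_poly (localization M F) * P (contraction M F) =
          char_poly (localization M F) * P' (contraction M F)" by simp
    qed simp
    then have eq: "rev_poly (rk M) (P M) - P M = rev_poly (rk M) (P' M) - P' M"
      using kl less.prems split[of P] split[of P'] by simp
    show ?thesis
    proof (rule poly_eqI)
      fix i
      show "coeff (P M) i = coeff (P' M) i"
      proof (cases "2 * i < rk M")
        case True
        have "coeff (P M) (rk M - i) = 0" "coeff (P' M) (rk M - i) = 0"
          using True deg by (auto intro!: coeff_eq_0)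
        then show ?thesis
          using arg_cong[OF eq, of "\<lambda>p. coeff p (rk M - i)"] True deg by (simp add: coeff_rev_poly)
      qed (use deg in \<open>simp add: coeff_eq_0\<close>)
    qed
  qed (use kl less.prems in auto)
qed

lemma kl_poly_eq_kl_rec: "kl_poly = kl_rec"
  unfolding kl_poly_def
proof (rule the_equality)
  show "kl_assignment kl_rec \<and> (\<forall>M. \<not> (matroid M \<and> loopless M) \<longrightarrow> kl_rec M = 0)"
    using kl_assignment_kl_rec by (auto simp: kl_rec.simps)
next
  fix P :: "'a indep_system \<Rightarrow> int poly"
  assume P: "kl_assignment P \<and> (\<forall>M. \<not> (matroid M \<and> loopless M) \<longrightarrow> P M = 0)"
  show "P = kl_rec"
  proof
    fix M show "P M = kl_rec M"
    proof (cases "matroid M \<and> loopless M")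
      case True
      then show ?thesis using P kl_assignment_unique[OF _ kl_assignment_kl_rec] by blast
    qed (use P in \<open>auto simp: kl_rec.simps\<close>)
  qed
qed

text \<open>The guess-and-verify criterion. By induction from the ground set downwards,
  \<open>p G\<close> and the true polynomial are both the palindromic completion of the same sum
  over the flats strictly above \<open>G\<close>.\<close>

lemma kl_poly_contraction_eqI:
  assumes M: "matroid M" and G: "G \<in> flats M"
    and one: "p (ground M) = 1"
    and deg: "\<And>F. F \<in> flats M \<Longrightarrow> rank_of M F < rk M \<Longrightarrow> 2 * degree (p F) < rk M - rank_of M F"
    and pal: "\<And>F. F \<in> flats M \<Longrightarrow> palindromic (rk M - rank_of M F)
      (\<Sum>H | H \<in> flats M \<and> F \<subseteq> H. monom 1 (rank_of M H - rank_of M F) * p H)"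
  shows "kl_poly (contraction M G) = p G"
  using G
proof (induction "rk M - rank_of M G" arbitrary: G rule: less_induct)
  case less
  interpret matroid M by (rule M)
  let ?r = "rk M - rank_of M G"
  have MG: "matroid (contraction M G)" "loopless (contraction M G)" "rk (contraction M G) = ?r"
    using less.prems by (auto simp: matroid_contraction loopless_contraction rk_contraction flat_subset_ground)
  show ?case
  proof (cases "rank_of M G = rk M")
    case True
    then have "G = ground M" using less.prems flat_eq_ground_iff by simp
    then show ?thesis
      using True one kl_rec_rk_0[OF MG(1,2)] MG(3) by (simp add: kl_poly_eq_kl_rec)
  next
    case False
    then have lt: "rank_of M G < rk M"
      using rank_le_rk[OF flat_subset_ground[OF less.prems]] by simp
    define Q where "Q = (\<Sum>H | H \<in> flats M \<and> G \<subset> H. monom 1 (rank_of M H - rank_of M G) * p H)"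
    have split: "(\<Sum>H | H \<in> flats M \<and> G \<subseteq> H. monom 1 (rank_of M H - rank_of M G) * q H) =
        q G + (\<Sum>H | H \<in> flats M \<and> G \<subset> H. monom 1 (rank_of M H - rank_of M G) * q H)"
      for q :: "_ \<Rightarrow> int poly"
    proof -
      have "{H. H \<in> flats M \<and> G \<subseteq> H} = insert G {H. H \<in> flats M \<and> G \<subset> H}"
        using less.prems by auto
      then show ?thesis using finite_flats by simp
    qed
    have "p G = palindromic_completion ?r Q"
      using pal[OF less.prems] deg[OF less.prems lt] unfolding split Q_def[symmetric]
      by (intro palindromic_completion_unique) auto
    moreover have "(\<Sum>H | H \<in> flats M \<and> G \<subset> H. monom 1 (rank_of M H - rank_of M G) * kl_rec (contraction M H)) = Q"
      unfolding Q_def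
    proof (rule sum.cong)
      fix H assume H: "H \<in> {H. H \<in> flats M \<and> G \<subset> H}"
      then have "rank_of M G < rank_of M H"
        using less.prems flat_rank_strict_mono flat_subset_ground by blast
      then have "kl_poly (contraction M H) = p H"
        using H lt by (intro less.hyps) auto
      then show "monom 1 (rank_of M H - rank_of M G) * kl_rec (contraction M H) =
          monom 1 (rank_of M H - rank_of M G) * p H" by (simp add: kl_poly_eq_kl_rec)
    qed simp
    then have "kl_rec (contraction M G) = palindromic_completion ?r Q"
      using palindromic_kl_rec_upper_sum[OF M less.prems] degree_kl_rec[OF MG(1,2)] MG(3) lt
      unfolding split by (intro palindromic_completion_unique) auto
    ultimately show ?thesis by (simp add: kl_poly_eq_kl_rec)
  qed
qed

section \<open>Graphic matroids\<close>

abbreviation acyclic_edges :: "'v set set \<Rightarrow> bool" where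
  "acyclic_edges S \<equiv> (\<nexists>vs. is_cycle S vs)"

definition joined :: "'v set set \<Rightarrow> 'v \<Rightarrow> 'v \<Rightarrow> bool" where
  "joined S a b \<longleftrightarrow> (\<exists>vs. vs \<noteq> [] \<and> distinct vs \<and> hd vs = a \<and> last vs = b \<and>
     (\<forall>i. Suc i < length vs \<longrightarrow> {vs ! i, vs ! Suc i} \<in> S))"

text \<open>Stands in for connected components: a labelling that separates two vertices certifies
  that they are not connected, with no path to handle.\<close>

definition constant_on_edges :: "('v \<Rightarrow> 'c) \<Rightarrow> 'v set set \<Rightarrow> bool" where
  "constant_on_edges l S \<longleftrightarrow> (\<forall>x y. {x, y} \<in> S \<longrightarrow> l x = l y)"

lemma joined_refl: "joined S a a"
  unfolding joined_def by (rule exI[of _ "[a]"]) simp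

text \<open>Paths have distinct vertices so that they close up to cycles directly. Hence a path that
  already visits \<open>y\<close> is cut there instead of extended.\<close>

lemma joined_step:
  assumes "joined S a x" "{x, y} \<in> S"
  shows "joined S a y"
proof -
  obtain vs where vs: "vs \<noteq> []" "distinct vs" "hd vs = a" "last vs = x"
    "\<And>i. Suc i < length vs \<Longrightarrow> {vs ! i, vs ! Suc i} \<in> S"
    using assms(1) by (auto simp: joined_def)
  show ?thesis
  proof (cases "y \<in> set vs")
    case True
    then obtain j where j: "j < length vs" "y = vs ! j" by (metis in_set_conv_nth)
    then have "last (take (Suc j) vs) = y" by (simp add: take_Suc_conv_app_nth)
    then show ?thesis
      unfolding joined_def using vs j by (intro exI[of _ "take (Suc j) vs"]) auto
  next
    case False
    have "{(vs @ [y]) ! i, (vs @ [y]) ! Suc i} \<in> S" if "Suc i < length (vs @ [y])" for i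
    proof (cases "Suc i < length vs")
      case False
      then have "i = length vs - 1" "Suc i = length vs" using that by auto
      then have "vs ! i = x" "Suc i = length vs" using vs by (simp_all add: last_conv_nth)
      then show ?thesis using assms(2) by (simp add: nth_append)
    qed (use vs in \<open>simp add: nth_append\<close>)
    then show ?thesis
      unfolding joined_def using vs False by (intro exI[of _ "vs @ [y]"]) auto
  qed
qed

lemma constant_on_edges_joined: "constant_on_edges (joined S a) S"
  unfolding constant_on_edges_def using joined_step by (metis insert_commute)

lemma ex_cycle_insert:
  assumes "joined S a b" "a \<noteq> b" "{a, b} \<notin> S"
  shows "\<exists>vs. is_cycle (insert {a, b} S) vs"
proof -
  obtain vs where vs: "vs \<noteq> []" "distinct vs" "hd vs = a" "last vs = b"
    "\<And>i. Suc i < length vs \<Longrightarrow> {vs ! i, vs ! Suc i} \<in> S"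
    using assms(1) by (auto simp: joined_def)
  have ends: "vs ! 0 = a" "vs ! (length vs - 1) = b"
    using vs by (simp_all add: hd_conv_nth last_conv_nth)
  \<comment> \<open>Length 1 would force \<open>a = b\<close>, and length 2 would put the edge
    \<open>{a, b}\<close> into \<open>S\<close>.\<close>
  have "length vs \<noteq> 1" "length vs \<noteq> 2"
    using ends assms vs(5)[of 0] by auto
  then have "length vs \<ge> 3"
    using vs(1) by (metis One_nat_def Suc_leI length_greater_0_conv nat_less_le numeral_2_eq_2 numeral_3_eq_3)
  moreover have "{vs ! i, vs ! (Suc i mod length vs)} \<in> insert {a, b} S" if "i < length vs" for i
  proof (cases "Suc i < length vs")
    case False
    then have "i = length vs - 1" "Suc i = length vs" using that by auto
    then show ?thesis using ends by (simp add: insert_commute)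
  qed (use vs(5) in simp)
  ultimately show ?thesis
    unfolding is_cycle_def using vs(2) by blast
qed

lemma is_cycle_mono: "is_cycle S vs \<Longrightarrow> S \<subseteq> T \<Longrightarrow> is_cycle T vs"
  by (auto simp: is_cycle_def)

lemma acyclic_edges_empty: "acyclic_edges {}"
  by (auto simp: is_cycle_def intro!: exI[of _ 0])

text \<open>
  Going around a cycle through the new edge, the labelling would change exactly once.
\<close>

lemma acyclic_edges_insert:
  assumes S: "acyclic_edges S" and l: "constant_on_edges l S" and ab: "l a \<noteq> l b"
  shows "acyclic_edges (insert {a, b} S)"
proof
  assume "\<exists>vs. is_cycle (insert {a, b} S) vs"
  then obtain vs where "is_cycle (insert {a, b} S) vs" by blast
  then have vs: "length vs \<ge> 3" "distinct vs"
    "\<And>i. i < length vs \<Longrightarrow> {vs ! i, vs ! (Suc i mod length vs)} \<in> insert {a, b} S"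
    by (auto simp: is_cycle_def)
  define m where "m = length vs"
  have "\<exists>i<m. {vs ! i, vs ! (Suc i mod m)} = {a, b}"
  proof (rule ccontr)
    assume "\<not> ?thesis"
    then have "is_cycle S vs" using vs by (auto simp: is_cycle_def m_def)
    then show False using S by blast
  qed
  then obtain i where i: "i < m" "{vs ! i, vs ! (Suc i mod m)} = {a, b}" by blast
  \<comment> \<open>The new edge occurs only once on the cycle: two positions carrying the same edge
    would force a cycle of length 2.\<close>
  have other: "{vs ! j, vs ! (Suc j mod m)} \<in> S" if "j < m" "j \<noteq> i" for j
  proof -
    have "{vs ! j, vs ! (Suc j mod m)} \<noteq> {vs ! i, vs ! (Suc i mod m)}"
    proof
      assume "{vs ! j, vs ! (Suc j mod m)} = {vs ! i, vs ! (Suc i mod m)}"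
      moreover have "vs ! j \<noteq> vs ! i"
        using that i vs(2) by (simp add: nth_eq_iff_index_eq m_def)
      ultimately have "vs ! j = vs ! (Suc i mod m)" "vs ! (Suc j mod m) = vs ! i"
        by (auto simp: doubleton_eq_iff)
      moreover have "Suc i mod m < m" "Suc j mod m < m" using i by auto
      ultimately have "j = Suc i mod m" "Suc j mod m = i"
        using that i vs(2) by (auto simp: nth_eq_iff_index_eq m_def)
      then show False
        using that i vs(1) by (auto simp: m_def mod_Suc split: if_splits)
    qed
    then show ?thesis using vs(3)[of j] that i by (auto simp: m_def)
  qed
  have "l (vs ! ((Suc i + k) mod m)) = l (vs ! (Suc i mod m))" if "k < m" for k
    using that
  proof (induction k)
    case (Suc k)
    have "(Suc i + k) mod m \<noteq> i"
    proof (cases "Suc i + k < m")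
      case False
      then have "(Suc i + k) mod m = Suc i + k - m"
        using Suc.prems i by (simp add: mod_if)
      then show ?thesis using Suc.prems False by linarith
    qed simp
    then have "{vs ! ((Suc i + k) mod m), vs ! (Suc ((Suc i + k) mod m) mod m)} \<in> S"
      using i by (intro other) auto
    then have "l (vs ! ((Suc i + k) mod m)) = l (vs ! (Suc ((Suc i + k) mod m) mod m))"
      using l by (simp add: constant_on_edges_def)
    then show ?case using Suc by (simp add: mod_Suc_eq)
  qed simp
  \<comment> \<open>After \<open>m - 1\<close> steps from the far end of the new edge the walk
    arrives at its near end \<open>vs ! i\<close>.\<close>
  from this[of "m - 1"] have "l (vs ! i) = l (vs ! (Suc i mod m))"
    using i by simp
  then show False
    using i(2) ab by (auto simp: doubleton_eq_iff)
qed

text \<open>The second clause makes \<open>l\<close> the finest edge-constant labelling, the third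
  counts its classes. Adding a forest edge merges two classes; they are distinct because otherwise
  reachability from \<open>a\<close>, a boolean labelling, would yield a path from \<open>a\<close>
  to \<open>b\<close> and hence a cycle.\<close>

lemma ex_component_labelling:
  fixes I :: "'v set set"
  assumes "finite I" "acyclic_edges I" "finite V"
    and "\<And>e. e \<in> I \<Longrightarrow> \<exists>x\<in>V. \<exists>y\<in>V. x \<noteq> y \<and> e = {x, y}"
  shows "\<exists>l::'v \<Rightarrow> 'v. constant_on_edges l I \<and>
    (\<forall>(h::'v \<Rightarrow> bool) x y. constant_on_edges h I \<longrightarrow> l x = l y \<longrightarrow> h x = h y) \<and>
    card (l ` V) + card I = card V"
  using assms(1,2,4)
proof (induction I rule: finite_induct)
  case empty
  show ?case by (rule exI[of _ id]) (simp add: constant_on_edges_def)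
next
  case (insert e I)
  obtain a b where ab: "a \<in> V" "b \<in> V" "a \<noteq> b" "e = {a, b}"
    using insert.prems(2)[of e] by auto
  have "acyclic_edges I"
    using insert.prems(1) is_cycle_mono by (metis subset_insertI)
  then obtain l :: "'v \<Rightarrow> 'v" where l: "constant_on_edges l I"
    "\<And>(h::'v \<Rightarrow> bool) x y. constant_on_edges h I \<Longrightarrow> l x = l y \<Longrightarrow> h x = h y"
    "card (l ` V) + card I = card V"
    using insert.IH insert.prems by blast
  have ne: "l a \<noteq> l b"
  proof
    assume "l a = l b"
    then have "joined I a b"
      using l(2)[OF constant_on_edges_joined, of a b a] joined_refl by metis
    then show False
      using ex_cycle_insert insert.prems(1) insert.hyps ab by metis
  qed
  define l' where "l' x = (if l x = l a then l b else l x)" for x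
  have "constant_on_edges l' (insert e I)"
    using l(1) ab ne by (auto simp: constant_on_edges_def l'_def doubleton_eq_iff)
  moreover have "h x = h y" if h: "constant_on_edges h (insert e I)" "l' x = l' y" for h :: "'v \<Rightarrow> bool" and x y
  proof -
    have "constant_on_edges h I" "h a = h b"
      using h(1) ab by (auto simp: constant_on_edges_def)
    then show ?thesis
      using l(2)[of h] h(2) unfolding l'_def by metis
  qed
  moreover have "l' ` V = l ` V - {l a}"
    using ab ne by (auto simp: l'_def image_iff)
  then have "card (l' ` V) + 1 = card (l ` V)"
    using ab assms(3) card_Suc_Diff1[of "l ` V" "l a"] by simp
  then have "card (l' ` V) + card (insert e I) = card V"
    using l(3) insert.hyps by simp
  ultimately show ?case by blast
qed

section \<open>The matroid of a finite simple graph\<close>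

locale finite_simple_graph =
  fixes G :: "'v graph"
  assumes finite_vertices: "finite (fst G)"
    and edges: "e \<in> snd G \<Longrightarrow> \<exists>x\<in>fst G. \<exists>y\<in>fst G. x \<noteq> y \<and> e = {x, y}"
begin

lemma indeps_graphic_matroid: "I \<in> indeps (graphic_matroid G) \<longleftrightarrow> I \<subseteq> snd G \<and> acyclic_edges I"
  by (simp add: graphic_matroid_def)

lemma ground_graphic_matroid: "ground (graphic_matroid G) = snd G"
  by (simp add: graphic_matroid_def)

text \<open>Augmentation by counting components: if no edge of \<open>J\<close> left the components
  of \<open>I\<close>, then \<open>lI\<close> would factor through \<open>lJ\<close>, so
  \<open>J\<close> would have at least as many components and thus at most as many edges as
  \<open>I\<close>.\<close>

lemma matroid_graphic_matroid: "matroid (graphic_matroid G)"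
proof
  have "snd G \<subseteq> Pow (fst G)" using edges by fastforce
  then have fin: "finite (snd G)" using finite_vertices finite_subset by blast
  then show "finite (ground (graphic_matroid G))" by (simp add: ground_graphic_matroid)
  fix I J assume IJ: "I \<in> indeps (graphic_matroid G)" "J \<in> indeps (graphic_matroid G)" "card I < card J"
  then have I: "I \<subseteq> snd G" "acyclic_edges I" and J: "J \<subseteq> snd G" "acyclic_edges J"
    by (auto simp: indeps_graphic_matroid)
  obtain lI :: "'v \<Rightarrow> 'v" where lI: "constant_on_edges lI I" "card (lI ` fst G) + card I = card (fst G)"
    using ex_component_labelling[OF finite_subset[OF I(1) fin] I(2) finite_vertices edges] I(1) by blast
  obtain lJ :: "'v \<Rightarrow> 'v" where lJ: "card (lJ ` fst G) + card J = card (fst G)"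
    "\<And>(h::'v \<Rightarrow> bool) x y. constant_on_edges h J \<Longrightarrow> lJ x = lJ y \<Longrightarrow> h x = h y"
    using ex_component_labelling[OF finite_subset[OF J(1) fin] J(2) finite_vertices edges] J(1) by blast
  have "\<not> constant_on_edges lI J"
  proof
    assume const: "constant_on_edges lI J"
    \<comment> \<open>The clause for \<open>lJ\<close> concerns boolean labellings, so
      \<open>lI\<close> enters through the indicator of a single class.\<close>
    have factor: "lI x = lI y" if "lJ x = lJ y" for x y
      using lJ(2)[of "\<lambda>z. lI z = lI x" x y] const that by (simp add: constant_on_edges_def)
    have "lI ` fst G \<subseteq> (\<lambda>c. lI (SOME x. lJ x = c)) ` lJ ` fst G"
    proof
      fix c assume "c \<in> lI ` fst G"
      then obtain x where x: "x \<in> fst G" "c = lI x" by auto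
      have "lJ (SOME y. lJ y = lJ x) = lJ x" by (rule someI[of "\<lambda>y. lJ y = lJ x" x]) simp
      then have "c = lI (SOME y. lJ y = lJ x)" using factor[of "SOME y. lJ y = lJ x" x] x by simp
      then show "c \<in> (\<lambda>c. lI (SOME x. lJ x = c)) ` lJ ` fst G"
        using x by blast
    qed
    then have "card (lI ` fst G) \<le> card (lJ ` fst G)"
      using finite_vertices by (meson surj_card_le finite_imageI)
    then show False using lI(2) lJ(1) IJ(3) by simp
  qed
  then obtain x y where xy: "{x, y} \<in> J" "lI x \<noteq> lI y"
    by (auto simp: constant_on_edges_def)
  then have "{x, y} \<notin> I" using lI(1) by (auto simp: constant_on_edges_def)
  then show "\<exists>e\<in>J - I. insert e I \<in> indeps (graphic_matroid G)"
    using xy acyclic_edges_insert[OF I(2) lI(1) xy(2)] I J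
    by (intro bexI[of _ "{x, y}"]) (auto simp: indeps_graphic_matroid)
qed (auto simp: indeps_graphic_matroid ground_graphic_matroid acyclic_edges_empty intro: is_cycle_mono)

end

section \<open>The generating functions\<close>

unbundle fps_syntax

text \<open>
  Coefficients of the power series \<open>D\<close> with \<open>D = u * (1 + D + t * D ^ 2)\<close>; for positive index they
  turn out to be the Kazhdan--Lusztig polynomials of the fans.
\<close>

fun motzkin_poly :: "nat \<Rightarrow> int poly" where
  "motzkin_poly 0 = 0"
| "motzkin_poly (Suc n) = (if n = 0 then 1 else 0) + motzkin_poly n +
     [:0, 1:] * (\<Sum>i=0..n. motzkin_poly i * motzkin_poly (n - i))"

text \<open>Corrects index 0 only: a segment without blocks contributes the rank 0 value 1, whereas
  the series D has no constant term.\<close>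

definition fan_kl :: "nat \<Rightarrow> int poly" where
  "fan_kl k = (if k = 0 then 1 else motzkin_poly k)"

lemma fan_kl_0 [simp]: "fan_kl 0 = 1"
  by (simp add: fan_kl_def)

lemma degree_motzkin_poly: "n > 0 \<Longrightarrow> 2 * degree (motzkin_poly n) < n"
proof (induction n rule: less_induct)
  case (less n)
  then obtain m where n: "n = Suc m" by (cases n) auto
  have prod: "degree ([:0, 1:] * (motzkin_poly i * motzkin_poly (m - i))) \<le> m div 2" if "i \<le> m" for i
  \<comment> \<open>The end terms vanish with \<open>motzkin_poly 0\<close>. Elsewhere two strict
    bounds leave a slack of 2 in twice the degree, exactly what the factor t uses up.\<close>
  proof (cases "i = 0 \<or> i = m")
    case False
    then have "2 * degree (motzkin_poly i) < i" "2 * degree (motzkin_poly (m - i)) < m - i"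
      using less.IH that n by auto
    moreover have "degree ([:0, 1:] * (motzkin_poly i * motzkin_poly (m - i))) \<le>
        1 + (degree (motzkin_poly i) + degree (motzkin_poly (m - i)))"
      by (intro order_trans[OF degree_mult_le] add_mono degree_mult_le) simp
    ultimately show ?thesis using that by linarith
  qed auto
  have "degree (motzkin_poly m) \<le> m div 2"
    using less.IH[of m] n by (cases "m = 0") auto
  then have "degree (motzkin_poly n) \<le> m div 2"
    unfolding n motzkin_poly.simps sum_distrib_left
    using prod by (intro degree_add_le degree_sum_le) auto
  then show ?case using n by linarith
qed

lemma degree_fan_kl: "k > 0 \<Longrightarrow> 2 * degree (fan_kl k) < k"
  using degree_motzkin_poly by (simp add: fan_kl_def)

abbreviation fps_t :: "int poly fps" where
  "fps_t \<equiv> fps_const [:0, 1:]"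

definition motzkin_fps :: "int poly fps" where
  "motzkin_fps = Abs_fps motzkin_poly"

lemma motzkin_fps_eq:
  "motzkin_fps = fps_X * (1 + motzkin_fps + fps_t * (motzkin_fps * motzkin_fps))"
proof (rule fps_ext)
  fix n show "motzkin_fps $ n = (fps_X * (1 + motzkin_fps + fps_t * (motzkin_fps * motzkin_fps))) $ n"
    by (cases n) (simp_all add: motzkin_fps_def fps_mult_nth[of "Abs_fps motzkin_poly"])
qed

definition geometric_t :: "int poly fps" where
  "geometric_t = Abs_fps (\<lambda>n. [:0, 1:] ^ n)"

lemma geometric_t: "(1 - fps_t * fps_X) * geometric_t = 1"
proof (rule fps_ext)
  fix n show "((1 - fps_t * fps_X) * geometric_t) $ n = 1 $ n"
    by (cases n) (simp_all add: geometric_t_def left_diff_distrib mult.assoc)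
qed

definition narayana_fps :: "int poly fps" where
  "narayana_fps = motzkin_fps oo (fps_X * geometric_t)"

text \<open>Clearing the denominator 1 - tu after the substitution leaves the term tuN, which
  completes 1 + N + tN^2 to the product (1 + N)(1 + tN).\<close>

lemma narayana_fps_eq: "narayana_fps = fps_X * ((1 + narayana_fps) * (1 + fps_t * narayana_fps))"
proof -
  let ?v = "fps_X * geometric_t" and ?N = narayana_fps
  have v0: "?v $ 0 = 0" by simp
  have "?N = ?v * (1 + ?N + fps_t * (?N * ?N))"
    unfolding narayana_fps_def
    by (subst motzkin_fps_eq)
      (simp add: fps_compose_mult_distrib[OF v0] fps_compose_add_distrib fps_X_fps_compose_startby0[OF v0])
  from arg_cong[OF this, of "\<lambda>x. (1 - fps_t * fps_X) * x"]
  have "(1 - fps_t * fps_X) * ?N = ((1 - fps_t * fps_X) * geometric_t) * (fps_X * (1 + ?N + fps_t * (?N * ?N)))"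
    by (simp only: mult_ac)
  then have eq: "(1 - fps_t * fps_X) * ?N = fps_X * (1 + ?N + fps_t * (?N * ?N))"
    by (simp only: geometric_t mult_1_left)
  have "?N = fps_t * fps_X * ?N + (1 - fps_t * fps_X) * ?N"
    by (simp add: algebra_simps)
  also note eq
  also have "fps_t * fps_X * ?N + fps_X * (1 + ?N + fps_t * (?N * ?N)) = fps_X * ((1 + ?N) * (1 + fps_t * ?N))"
    by (simp add: algebra_simps)
  finally show ?thesis .
qed

section \<open>The series Z and its palindromic coefficients\<close>

definition fan_Z :: "int poly fps" where
  "fan_Z = (1 + narayana_fps) * (1 + fps_t * narayana_fps)"

lemma narayana_fps_eq_fan_Z: "narayana_fps = fps_X * fan_Z"
  unfolding fan_Z_def by (rule narayana_fps_eq)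

lemma fan_Z_eq: "fan_Z = 1 + (1 + fps_t) * fps_X * fan_Z + fps_t * fps_X * (fps_X * (fan_Z * fan_Z))"
proof -
  have "fan_Z = (1 + fps_X * fan_Z) * (1 + fps_t * (fps_X * fan_Z))"
    unfolding narayana_fps_eq_fan_Z[symmetric] by (rule fan_Z_def)
  also have "\<dots> = 1 + (1 + fps_t) * fps_X * fan_Z + fps_t * fps_X * (fps_X * (fan_Z * fan_Z))"
    by (simp add: algebra_simps)
  finally show ?thesis .
qed

lemma fan_Z_nth_0: "fan_Z $ 0 = 1"
  by (subst fan_Z_eq) (simp add: mult.assoc)

lemma fan_Z_nth_Suc:
  "fan_Z $ Suc n = [:1, 1:] * fan_Z $ n +
     (if n = 0 then 0 else [:0, 1:] * (\<Sum>i=0..n - 1. fan_Z $ i * fan_Z $ (n - 1 - i)))"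
proof -
  have "1 + fps_t = fps_const [:1, 1:]"
    by (rule fps_ext) (simp add: one_pCons)
  then have "fan_Z $ Suc n = (1 + fps_const [:1, 1:] * (fps_X * fan_Z) + fps_t * (fps_X * (fps_X * (fan_Z * fan_Z)))) $ Suc n"
    by (subst fan_Z_eq) (simp only: mult.assoc)
  then show ?thesis
    by (cases n) (simp_all add: fps_mult_nth[of fan_Z])
qed

lemma palindromic_fan_Z: "palindromic n (fan_Z $ n)"
proof (induction n rule: less_induct)
  case (less n)
  show ?case
  proof (cases n)
    case 0
    then show ?thesis by (simp add: fan_Z_nth_0 palindromic_iff_coeff)
  next
    case (Suc m)
    have t1: "palindromic 1 [:1, 1:]"
      by (auto simp: palindromic_iff_coeff le_Suc_eq)
    \<comment> \<open>Read with degree 2, t has coefficients 0, 1, 0; this compensates the index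
      shift by 2 in the quadratic term.\<close>
    have t2: "palindromic 2 [:0, 1:]"
      by (auto simp: palindromic_iff_coeff numeral_2_eq_2 le_Suc_eq)
    have "palindromic n ([:1, 1:] * fan_Z $ m)"
      using palindromic_mult[OF t1 less.IH[of m]] Suc by simp
    moreover have "palindromic n ([:0, 1:] * (fan_Z $ i * fan_Z $ (m - 1 - i)))" if "i \<le> m - 1" "m \<noteq> 0" for i
      using palindromic_mult[OF t2 palindromic_mult[OF less.IH[of i] less.IH[of "m - 1 - i"]]] that Suc by simp
    ultimately show ?thesis
      unfolding Suc fan_Z_nth_Suc sum_distrib_left
      by (auto intro!: palindromic_add palindromic_sum simp del: mult_pCons_left)
  qed
qed

text \<open>
  \<open>transfer_fps k\<close> solves the linear system that sums over the words which extend a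
  fan word with \<open>k\<close> open blocks.
\<close>

definition transfer_fps :: "nat \<Rightarrow> int poly fps" where
  "transfer_fps k = (if k = 0 then fan_Z else
     geometric_t * (fps_shift k motzkin_fps oo (fps_X * geometric_t)) * (1 + fps_t * narayana_fps))"

text \<open>The two terms with \<open>fan_kl k\<close> combine to \<open>fan_kl k\<close> times 1 +
  tuZ = 1 + tN. Taking out 1 + tN for positive \<open>k\<close> leaves the linear recursion (1 - tu)
  T k = \<open>fan_kl k\<close> + u T (k + 1), solved by the k-fold shift of D at u/(1 - tu),
  divided by 1 - tu. For \<open>k = 0\<close> the equation reduces to the definition of
  \<open>fan_Z\<close>.\<close>

lemma transfer_fps_eq:
  "transfer_fps k = fps_const (fan_kl k) + fps_X *
     (transfer_fps (Suc k) + (if k > 0 then fps_t * transfer_fps k else 0) + fps_t * fan_Z * fps_const (fan_kl k))"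
proof -
  let ?v = "fps_X * geometric_t"
  have v0: "?v $ 0 = 0" by simp
  define D where "D k = fps_shift k motzkin_fps oo ?v" for k
  have D: "D k = fps_const (motzkin_poly k) + ?v * D (Suc k)" for k
  proof -
    have "fps_shift k motzkin_fps = fps_const (motzkin_poly k) + fps_X * fps_shift (Suc k) motzkin_fps"
    proof (rule fps_ext)
      fix n show "fps_shift k motzkin_fps $ n =
          (fps_const (motzkin_poly k) + fps_X * fps_shift (Suc k) motzkin_fps) $ n"
        by (cases n) (simp_all add: motzkin_fps_def)
    qed
    then show ?thesis
      unfolding D_def
      by (simp add: fps_compose_mult_distrib[OF v0] fps_compose_add_distrib fps_X_fps_compose_startby0[OF v0])
  qed
  have N: "narayana_fps = ?v * D 1"
    using D[of 0] by (simp add: D_def narayana_fps_def)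
  show ?thesis
  proof (cases "k = 0")
    case True
    have "fan_Z = (1 + ?v * D 1) * (1 + fps_t * narayana_fps)"
      unfolding fan_Z_def by (simp only: N[symmetric])
    also have "\<dots> = 1 + fps_t * narayana_fps + fps_X * transfer_fps 1"
      by (simp add: transfer_fps_def D_def algebra_simps)
    finally show ?thesis
      using True by (simp add: transfer_fps_def[of 0] narayana_fps_eq_fan_Z algebra_simps)
  next
    case False
    define T where "T k = geometric_t * D k" for k
    have "(1 - fps_t * fps_X) * T k =
        (1 - fps_t * fps_X) * geometric_t * (fps_const (motzkin_poly k) + fps_X * T (Suc k))"
      unfolding T_def by (subst D) (simp add: algebra_simps)
    then have eq: "(1 - fps_t * fps_X) * T k = fps_const (fan_kl k) + fps_X * T (Suc k)"
      using False by (simp only: geometric_t mult_1_left fan_kl_def if_False)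
    have "T k = (1 - fps_t * fps_X) * T k + fps_t * fps_X * T k"
      by (simp add: algebra_simps)
    also note eq
    finally have T: "T k = fps_const (fan_kl k) + fps_X * T (Suc k) + fps_t * fps_X * T k" .
    have W: "transfer_fps j = T j * (1 + fps_t * narayana_fps)" if "j \<noteq> 0" for j
      using that by (simp add: transfer_fps_def T_def D_def)
    have "transfer_fps k = (fps_const (fan_kl k) + fps_X * T (Suc k) + fps_t * fps_X * T k) * (1 + fps_t * narayana_fps)"
      unfolding W[OF False] by (subst T) (rule refl)
    also have "\<dots> = fps_const (fan_kl k) * (1 + fps_t * narayana_fps) + fps_X * transfer_fps (Suc k) + fps_t * fps_X * transfer_fps k"
      using False by (simp add: W algebra_simps)
    finally show ?thesis
      using False by (simp add: narayana_fps_eq_fan_Z algebra_simps)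
  qed
qed

text \<open>The summands stand for \<open>New\<close>, \<open>Join\<close> and \<open>Hub\<close>
  placed after \<open>k\<close> open blocks. The last two raise the rank and carry t;
  \<open>Join\<close> needs an open block, and \<open>Hub\<close> closes all of them at the price
  \<open>fan_kl k\<close>.\<close>

definition transfer_step :: "(nat \<Rightarrow> int poly) \<Rightarrow> nat \<Rightarrow> int poly" where
  "transfer_step f k = f (Suc k) + (if k > 0 then [:0, 1:] * f k else 0) + [:0, 1:] * f 0 * fan_kl k"

lemma transfer_step_power: "(transfer_step ^^ a) fan_kl k = transfer_fps k $ a"
proof (induction a arbitrary: k)
  case 0
  then show ?case by (subst transfer_fps_eq) simp
next
  case (Suc a)
  have "transfer_fps k $ Suc a = transfer_fps (Suc k) $ a +
      (if k > 0 then [:0, 1:] * transfer_fps k $ a else 0) + [:0, 1:] * transfer_fps 0 $ a * fan_kl k"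
    by (subst transfer_fps_eq) (simp add: transfer_fps_def[of 0] mult.assoc)
  then show ?case
    by (simp add: transfer_step_def[of "(transfer_step ^^ a) fan_kl"] Suc)
qed

section \<open>Closed form of the generating function\<close>

lemma fan_Z_quadratic:
  "fan_Z * (1 - (fps_t + 1) * fps_X - fps_t * fps_X ^ 2 * fan_Z) = 1"
proof -
  have "fan_Z - ((1 + fps_t) * fps_X * fan_Z + fps_t * fps_X * (fps_X * (fan_Z * fan_Z))) = 1"
    unfolding diff_eq_eq add.assoc[symmetric] by (rule fan_Z_eq)
  then show ?thesis by (simp add: algebra_simps power2_eq_square)
qed

text \<open>Completing the square: with a = 1 - (t + 1)u and b = tu^2, the relation Z(a - bZ) = 1
  gives (a - 2bZ)^2 = a^2 - 4b, and the constant term 1 selects the sign.\<close>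

lemma fan_Z_fps_sqrt:
  "fps_sqrt ((1 - (fps_t + 1) * fps_X) ^ 2 - 4 * fps_t * fps_X ^ 2) =
     1 - (fps_t + 1) * fps_X - 2 * fps_t * fps_X ^ 2 * fan_Z"
proof (rule fps_sqrt_eqI)
  let ?a = "1 - (fps_t + 1) * fps_X" and ?b = "fps_t * fps_X ^ 2"
  have "(?a - 2 * ?b * fan_Z) ^ 2 = ?a ^ 2 - 4 * ?b * (fan_Z * (?a - ?b * fan_Z))"
    by algebra
  then show "(1 - (fps_t + 1) * fps_X - 2 * fps_t * fps_X ^ 2 * fan_Z) ^ 2 =
      (1 - (fps_t + 1) * fps_X) ^ 2 - 4 * fps_t * fps_X ^ 2"
    unfolding fan_Z_quadratic by (simp add: mult.assoc)
qed (simp add: power2_eq_square mult.assoc fps_mult_nth_0)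

lemma to_fract_fan_Z:
  "to_fract fan_Z =
     2 / to_fract (fps_sqrt ((1 - (fps_t + 1) * fps_X) ^ 2 - 4 * fps_t * fps_X ^ 2) - (fps_t + 1) * fps_X + 1)"
    (is "_ = 2 / to_fract ?d")
proof -
  have "?d = 2 * (1 - (fps_t + 1) * fps_X - fps_t * fps_X ^ 2 * fan_Z)"
    unfolding fan_Z_fps_sqrt by (simp add: algebra_simps)
  then have "fan_Z * ?d = 2"
    by (simp only: mult.left_commute[of fan_Z] fan_Z_quadratic mult_1_right)
  then have "to_fract fan_Z * to_fract ?d = to_fract (1 + 1)"
    by (simp only: to_fract_mult[symmetric] one_add_one)
  then have eq: "to_fract fan_Z * to_fract ?d = 2"
    unfolding to_fract_add by (simp add: one_add_one)
  have "?d \<noteq> 0"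
  proof
    assume "?d = 0"
    then have "(2 :: int poly fps) = 0" using \<open>fan_Z * ?d = 2\<close> by (simp only: mult_zero_right)
    then have "(2 :: int poly fps) $ 0 = 0 $ 0" by (rule arg_cong)
    then show False by simp
  qed
  then have "to_fract ?d \<noteq> 0" by (simp only: to_fract_eq_0_iff not_False_eq_True)
  then show ?thesis using eq by (simp add: eq_divide_eq)
qed

section \<open>Flats of the fan as words\<close>

text \<open>
  A flat of the fan matroid on \<open>n\<close> rim vertices is encoded by a word of length \<open>n\<close>, whose head
  describes the last vertex \<open>n\<close>: it lies in the block of the hub vertex 0, or in the block
  of the previous vertex (which is not the block of the hub), or it starts a new block.
\<close>

datatype letter = Hub | Join | New

fun fan_word :: "letter list \<Rightarrow> bool" where
  "fan_word [] = True"
| "fan_word (x # w) = (fan_word w \<and> (x = Join \<longrightarrow> w \<noteq> [] \<and> hd w \<noteq> Hub))"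

fun fan_edges :: "nat \<Rightarrow> nat set set" where
  "fan_edges 0 = {}"
| "fan_edges (Suc n) = insert {0, Suc n} (fan_edges n \<union> (if n = 0 then {} else {{n, Suc n}}))"

text \<open>A rim edge lies in the flat when its ends share a block, hence also between two adjacent
  \<open>Hub\<close> letters.\<close>

fun word_edges :: "letter list \<Rightarrow> nat set set" where
  "word_edges [] = {}"
| "word_edges (x # w) = word_edges w \<union>
     (if x = Hub then {{0, Suc (length w)}} else {}) \<union>
     (if x = Join \<or> x = Hub \<and> w \<noteq> [] \<and> hd w = Hub then {{length w, Suc (length w)}} else {})"

text \<open>A basis of the flat: one edge for each letter other than \<open>New\<close>, linking the
  vertex to its block.\<close>

fun word_forest :: "letter list \<Rightarrow> nat set set" where
  "word_forest [] = {}"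
| "word_forest (x # w) = word_forest w \<union>
     (case x of Hub \<Rightarrow> {{0, Suc (length w)}} | Join \<Rightarrow> {{length w, Suc (length w)}} | New \<Rightarrow> {})"

fun word_rank :: "letter list \<Rightarrow> nat" where
  "word_rank [] = 0"
| "word_rank (x # w) = word_rank w + (if x = New then 0 else 1)"

fun word_label :: "letter list \<Rightarrow> nat \<Rightarrow> nat" where
  "word_label [] = id"
| "word_label (x # w) = (word_label w)(Suc (length w) :=
     (case x of Hub \<Rightarrow> 0 | Join \<Rightarrow> word_label w (length w) | New \<Rightarrow> Suc (length w)))"

lemma fan_edges_eq: "snd (fan_graph n) = fan_edges n"
proof (induction n)
  case 0
  then show ?case by (auto simp: fan_graph_def)
next
  case (Suc n)
  have "snd (fan_graph (Suc n)) = insert {0, Suc n} (snd (fan_graph n) \<union> (if n = 0 then {} else {{n, Suc n}}))"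
    by (auto simp: fan_graph_def le_Suc_eq less_Suc_eq)
  then show ?case by (simp add: Suc)
qed

lemma fan_edges_subset: "e \<in> fan_edges n \<Longrightarrow> e \<subseteq> {..n}"
proof (induction n)
  case (Suc n)
  then show ?case by (cases "e \<in> fan_edges n") (auto split: if_splits)
qed simp

lemma fresh_fan_edge: "Suc n \<in> e \<Longrightarrow> e \<notin> fan_edges n"
  using fan_edges_subset by fastforce

lemma finite_simple_fan_graph: "finite_simple_graph (fan_graph n)"
proof
  show "finite (fst (fan_graph n))" by (simp add: fan_graph_def)
next
  fix e assume "e \<in> snd (fan_graph n)"
  then consider i where "e = {i, i + 1}" "i + 1 \<le> n" | i where "e = {0, i}" "1 \<le> i" "i \<le> n"
    by (auto simp: fan_graph_def)
  then show "\<exists>x\<in>fst (fan_graph n). \<exists>y\<in>fst (fan_graph n). x \<noteq> y \<and> e = {x, y}"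
  proof cases
    case (1 i)
    then show ?thesis by (intro bexI[of _ i] bexI[of _ "i + 1"]) (auto simp: fan_graph_def)
  next
    case (2 i)
    then show ?thesis by (intro bexI[of _ 0] bexI[of _ i]) (auto simp: fan_graph_def)
  qed
qed

section \<open>Block labels and spanning forests of word flats\<close>

lemma word_edges_subset: "fan_word w \<Longrightarrow> word_edges w \<subseteq> fan_edges (length w)"
  by (induction w) auto

lemma word_forest_subset: "word_forest w \<subseteq> word_edges w"
  by (induction w) (auto split: letter.splits)

lemma word_label_length:
  "fan_word w \<Longrightarrow> w \<noteq> [] \<Longrightarrow> word_label w (length w) = 0 \<longleftrightarrow> hd w = Hub"
proof (induction w)
  case (Cons x w)
  then show ?case by (cases x) auto
qed simp

lemma word_label_0 [simp]: "word_label w 0 = 0"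
  by (induction w) auto

lemma word_label_le: "word_label w i \<le> i"
proof (induction w arbitrary: i)
  case (Cons x w)
  show ?case using Cons[of i] Cons[of "length w"] by (auto split: letter.splits)
qed simp

lemma word_label_edge:
  assumes "fan_word w"
  shows "({a, b} \<in> word_edges w \<longrightarrow> word_label w a = word_label w b) \<and>
    ({a, b} \<in> fan_edges (length w) - word_edges w \<longrightarrow> word_label w a \<noteq> word_label w b)"
  using assms
proof (induction w)
  case (Cons x w)
  let ?n = "length w"
  have w: "fan_word w" using Cons.prems by simp
  have IH: "{a, b} \<in> word_edges w \<Longrightarrow> word_label w a = word_label w b"
    "{a, b} \<in> fan_edges ?n - word_edges w \<Longrightarrow> word_label w a \<noteq> word_label w b"
    using Cons.IH[OF w] by auto
  have old: "a \<noteq> Suc ?n \<and> b \<noteq> Suc ?n" if "{a, b} \<in> fan_edges ?n"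
    using fan_edges_subset[OF that] by auto
  have le: "word_label w ?n \<le> ?n" by (rule word_label_le)
  have hub: "word_label w ?n = 0 \<longleftrightarrow> w = [] \<or> hd w = Hub"
    using word_label_length[OF w] by (cases "w = []") auto
  show ?case
  proof (intro conjI impI)
    assume "{a, b} \<in> word_edges (x # w)"
    then consider "{a, b} \<in> word_edges w" | "{a, b} = {0, Suc ?n}" "x = Hub" |
      "{a, b} = {?n, Suc ?n}" "x = Join \<or> x = Hub \<and> w \<noteq> [] \<and> hd w = Hub"
      by (auto split: if_splits)
    then show "word_label (x # w) a = word_label (x # w) b"
    proof cases
      case 1
      then show ?thesis using IH(1) old word_edges_subset[OF w] by auto
    qed (auto simp: doubleton_eq_iff hub)
  next
    assume ab: "{a, b} \<in> fan_edges (length (x # w)) - word_edges (x # w)"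
    then consider "{a, b} \<in> fan_edges ?n - word_edges w" | "{a, b} = {0, Suc ?n}" "x \<noteq> Hub" |
      "{a, b} = {?n, Suc ?n}" "w \<noteq> []" "x = New \<or> x = Hub \<and> hd w \<noteq> Hub"
      by (cases x) (auto split: if_splits)
    then show "word_label (x # w) a \<noteq> word_label (x # w) b"
    proof cases
      case 1
      then show ?thesis using IH(2) old by auto
    next
      case 2
      then show ?thesis using hub Cons.prems by (cases x) (auto simp: doubleton_eq_iff)
    next
      case 3
      then show ?thesis using hub le by (auto simp: doubleton_eq_iff)
    qed
  qed
qed auto

lemma constant_on_word_label: "fan_word w \<Longrightarrow> constant_on_edges (word_label w) (word_edges w)"
  using word_label_edge by (auto simp: constant_on_edges_def)

lemma fan_edges_doubleton:
  assumes "e \<in> fan_edges n"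
  obtains a b where "e = {a, b}"
proof -
  interpret finite_simple_graph "fan_graph n" by (rule finite_simple_fan_graph)
  show ?thesis using edges[of e] assms that by (auto simp: fan_edges_eq)
qed

text \<open>Each added edge makes the newest vertex a leaf, and the indicator of that vertex is
  constant on the older edges.\<close>

lemma acyclic_word_forest:
  assumes "fan_word w"
  shows "acyclic_edges (word_forest w)" "card (word_forest w) = word_rank w" "finite (word_forest w)"
proof -
  have "acyclic_edges (word_forest w) \<and> card (word_forest w) = word_rank w \<and> finite (word_forest w)"
    using assms
  proof (induction w)
    case (Cons x w)
    let ?n = "length w"
    have IH: "acyclic_edges (word_forest w)" "card (word_forest w) = word_rank w" "finite (word_forest w)"
      and w: "fan_word w" using Cons by auto
    have sub: "e \<subseteq> {..?n}" if "e \<in> word_forest w" for e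
      using that word_forest_subset word_edges_subset[OF w] fan_edges_subset by blast
    then have const: "constant_on_edges (\<lambda>i. i = Suc ?n) (word_forest w)"
      by (fastforce simp: constant_on_edges_def)
    have new: "{i, Suc ?n} \<notin> word_forest w" for i
      using sub[of "{i, Suc ?n}"] by auto
    have "acyclic_edges (insert {i, Suc ?n} (word_forest w))" if "i \<le> ?n" for i
      using acyclic_edges_insert[OF IH(1) const, of i "Suc ?n"] that by auto
    then show ?case using IH new by (cases x) auto
  qed (simp add: acyclic_edges_empty)
  then show "acyclic_edges (word_forest w)" "card (word_forest w) = word_rank w" "finite (word_forest w)"
    by auto
qed

lemma triangle_is_cycle:
  assumes "n > 0"
  shows "is_cycle {{0, n}, {0, Suc n}, {n, Suc n}} [0, n, Suc n]"
proof -
  let ?vs = "[0, n, Suc n]"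
  have "{?vs ! i, ?vs ! (Suc i mod length ?vs)} \<in> {{0, n}, {0, Suc n}, {n, Suc n}}" if "i < length ?vs" for i
  proof -
    from that consider "i = 0" | "i = 1" | "i = 2" by fastforce
    then show ?thesis by cases (simp_all add: insert_commute)
  qed
  then show ?thesis using assms by (simp add: is_cycle_def)
qed

lemma hub_in_word_forest: "w \<noteq> [] \<Longrightarrow> hd w = Hub \<Longrightarrow> {0, length w} \<in> word_forest w"
  by (cases w) auto

text \<open>The flat edges missing from the forest are rim edges between adjacent \<open>Hub\<close>
  letters; each closes a triangle with the two spokes.\<close>

lemma ex_cycle_insert_word_forest:
  "e \<in> word_edges w \<Longrightarrow> e \<notin> word_forest w \<Longrightarrow> \<exists>vs. is_cycle (insert e (word_forest w)) vs"
proof (induction w)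
  case (Cons x w)
  let ?n = "length w"
  show ?case
  proof (cases "e \<in> word_edges w")
    case True
    then obtain vs where "is_cycle (insert e (word_forest w)) vs"
      using Cons by auto
    then show ?thesis by (intro exI[of _ vs]) (auto intro: is_cycle_mono)
  next
    case False
    then have e: "e = {?n, Suc ?n}" "x = Hub" "w \<noteq> []" "hd w = Hub"
      using Cons.prems by (auto split: if_splits letter.splits)
    then show ?thesis
      using hub_in_word_forest[of w]
      by (intro exI[of _ "[0, ?n, Suc ?n]"] is_cycle_mono[OF triangle_is_cycle]) auto
  qed
qed simp

definition fan_words :: "nat \<Rightarrow> letter list set" where
  "fan_words n = {w. fan_word w \<and> length w = n}"

abbreviation fan_matroid :: "nat \<Rightarrow> nat set indep_system" where
  "fan_matroid n \<equiv> graphic_matroid (fan_graph n)"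

lemma matroid_fan: "matroid (fan_matroid n)"
  using finite_simple_graph.matroid_graphic_matroid[OF finite_simple_fan_graph] .

lemma indeps_fan: "I \<in> indeps (fan_matroid n) \<longleftrightarrow> I \<subseteq> fan_edges n \<and> acyclic_edges I"
  by (simp add: finite_simple_graph.indeps_graphic_matroid[OF finite_simple_fan_graph] fan_edges_eq)

lemma ground_fan: "ground (fan_matroid n) = fan_edges n"
  by (simp add: finite_simple_graph.ground_graphic_matroid[OF finite_simple_fan_graph] fan_edges_eq)

lemma word_forest_indep: "w \<in> fan_words n \<Longrightarrow> word_forest w \<in> indeps (fan_matroid n)"
  using acyclic_word_forest word_edges_subset word_forest_subset
  by (fastforce simp: indeps_fan fan_words_def)

lemma rank_word_edges:
  assumes "w \<in> fan_words n"
  shows "rank_of (fan_matroid n) (word_edges w) = word_rank w"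
proof -
  have "rank_of (fan_matroid n) (word_edges w) = card (word_forest w)"
    using word_forest_indep[OF assms] word_forest_subset ex_cycle_insert_word_forest
    by (intro matroid.card_eq_rank[OF matroid_fan]) (auto simp: indeps_fan)
  then show ?thesis using acyclic_word_forest assms by (simp add: fan_words_def)
qed

lemma word_edges_flat:
  assumes "w \<in> fan_words n"
  shows "word_edges w \<in> flats (fan_matroid n)"
proof -
  interpret matroid "fan_matroid n" by (rule matroid_fan)
  have w: "fan_word w" "length w = n" using assms by (auto simp: fan_words_def)
  have "rank_of (fan_matroid n) (word_edges w) < rank_of (fan_matroid n) (insert e (word_edges w))"
    if e: "e \<in> fan_edges n - word_edges w" for e
  proof -
    obtain a b where ab: "e = {a, b}" using fan_edges_doubleton e by blast
    \<comment> \<open>An edge outside the flat joins different blocks, so the block labels certify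
      that adding it to the forest creates no cycle.\<close>
    have "word_label w a \<noteq> word_label w b"
      using word_label_edge[OF w(1)] e ab w by simp
    moreover have "constant_on_edges (word_label w) (word_forest w)"
      using constant_on_word_label[OF w(1)] word_forest_subset by (auto simp: constant_on_edges_def)
    ultimately have "acyclic_edges (insert e (word_forest w))"
      using acyclic_edges_insert acyclic_word_forest(1)[OF w(1)] ab by metis
    then have "insert e (word_forest w) \<in> indeps (fan_matroid n)"
      using word_forest_indep[OF assms] e by (auto simp: indeps_fan)
    then show ?thesis
      using rank_insert_greater_iff[OF word_forest_indep[OF assms] word_forest_subset] e
        rank_word_edges[OF assms] acyclic_word_forest(2)[OF w(1)] by simp
  qed
  then show ?thesis
    using word_edges_subset w by (auto simp: flats_def ground_fan)
qed

section \<open>Every flat comes from a word\<close>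

definition triangle_closed :: "nat \<Rightarrow> nat set set \<Rightarrow> bool" where
  "triangle_closed n F \<longleftrightarrow> F \<subseteq> fan_edges n \<and> (\<forall>i. 0 < i \<and> i < n \<longrightarrow>
     ({0, i} \<in> F \<and> {0, Suc i} \<in> F \<longrightarrow> {i, Suc i} \<in> F) \<and>
     ({0, i} \<in> F \<and> {i, Suc i} \<in> F \<longrightarrow> {0, Suc i} \<in> F) \<and>
     ({0, Suc i} \<in> F \<and> {i, Suc i} \<in> F \<longrightarrow> {0, i} \<in> F))"

lemma fan_edges_iff:
  "e \<in> fan_edges n \<longleftrightarrow> (\<exists>i. 0 < i \<and> i \<le> n \<and> e = {0, i}) \<or> (\<exists>i. 0 < i \<and> i < n \<and> e = {i, Suc i})"
  unfolding fan_edges_eq[symmetric] by (simp add: fan_graph_def Suc_le_eq) blast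

lemma acyclic_two_edges:
  assumes "a \<noteq> b" "c \<noteq> d" "b \<notin> {c, d}"
  shows "acyclic_edges {{a, b}, {c, d}}"
proof -
  have "acyclic_edges {{c, d}}"
    using acyclic_edges_insert[OF acyclic_edges_empty, of id c d] assms by (simp add: constant_on_edges_def)
  then show ?thesis
    using assms by (rule_tac acyclic_edges_insert[of _ "\<lambda>x. x = b"])
      (auto simp: constant_on_edges_def doubleton_eq_iff)
qed

lemma flat_triangle_closed:
  assumes F: "F \<in> flats (fan_matroid n)"
  shows "triangle_closed n F"
proof -
  interpret matroid "fan_matroid n" by (rule matroid_fan)
  have sub: "F \<subseteq> fan_edges n" using F flat_subset_ground by (simp add: ground_fan)
  have third: "e \<in> F" if "{x, y} \<subseteq> F" "acyclic_edges {x, y}" "e \<in> fan_edges n"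
    "is_cycle {e, x, y} vs" for e x y vs
    using that sub F by (intro flat_closed[of F "{x, y}" e]) (auto simp: indeps_fan ground_fan)
  show ?thesis
    unfolding triangle_closed_def
  proof (intro conjI allI impI sub; elim conjE)
    fix i assume i: "0 < i" "i < n"
    have cyc: "is_cycle S [0, i, Suc i]" if "S = {{0, i}, {0, Suc i}, {i, Suc i}}" for S
      using triangle_is_cycle[OF i(1)] that by simp
    have edges: "{0, i} \<in> fan_edges n" "{0, Suc i} \<in> fan_edges n" "{i, Suc i} \<in> fan_edges n"
      using i unfolding fan_edges_iff by (metis Suc_leI less_imp_le zero_less_Suc)+
    show "{i, Suc i} \<in> F" if "{0, i} \<in> F" "{0, Suc i} \<in> F"
      using that i edges
      by (intro third[of "{0, Suc i}" "{0, i}" _ "[0, i, Suc i]"] acyclic_two_edges cyc) auto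
    show "{0, Suc i} \<in> F" if "{0, i} \<in> F" "{i, Suc i} \<in> F"
      using that i edges
      by (intro third[of "{i, Suc i}" "{0, i}" _ "[0, i, Suc i]"] acyclic_two_edges cyc) auto
    show "{0, i} \<in> F" if "{0, Suc i} \<in> F" "{i, Suc i} \<in> F"
      using that i edges acyclic_two_edges[of "Suc i" i 0 "Suc i"]
      by (intro third[of "{i, Suc i}" "{0, Suc i}" _ "[0, i, Suc i]"] cyc) (auto simp: insert_commute)
  qed
qed

lemma word_edges_Cons_iff:
  assumes "fan_word (x # w)"
  shows "{0, Suc (length w)} \<in> word_edges (x # w) \<longleftrightarrow> x = Hub"
    and "w \<noteq> [] \<Longrightarrow> {length w, Suc (length w)} \<in> word_edges (x # w) \<longleftrightarrow> x = Join \<or> x = Hub \<and> hd w = Hub"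
    and "word_edges (x # w) \<inter> fan_edges (length w) = word_edges w"
proof -
  have sub: "word_edges w \<subseteq> fan_edges (length w)" using assms by (simp add: word_edges_subset)
  have fresh: "{i, Suc (length w)} \<notin> fan_edges (length w)" for i
    by (rule fresh_fan_edge) simp
  have fresh': "{i, Suc (length w)} \<notin> word_edges w" for i
    using fresh sub by blast
  show "{0, Suc (length w)} \<in> word_edges (x # w) \<longleftrightarrow> x = Hub"
    using fresh' assms by (auto simp: doubleton_eq_iff)
  show "w \<noteq> [] \<Longrightarrow> {length w, Suc (length w)} \<in> word_edges (x # w) \<longleftrightarrow> x = Join \<or> x = Hub \<and> hd w = Hub"
    using fresh' by (auto simp: doubleton_eq_iff)
  show "word_edges (x # w) \<inter> fan_edges (length w) = word_edges w"
    using fresh sub by auto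
qed

lemma spoke_in_word_edges_iff:
  "fan_word w \<Longrightarrow> w \<noteq> [] \<Longrightarrow> {0, length w} \<in> word_edges w \<longleftrightarrow> hd w = Hub"
  using word_edges_Cons_iff(1)[of "hd w" "tl w"] by (cases w) auto

text \<open>The last letter is read off the last spoke and rim edge. Closure under the last triangle
  makes it fit the rest: the rim edge between two \<open>Hub\<close> letters is present, and
  \<open>Join\<close> never follows \<open>Hub\<close>. Triangles alone thus characterise the
  flats.\<close>

lemma triangle_closed_word:
  assumes "triangle_closed n F"
  shows "\<exists>w\<in>fan_words n. word_edges w = F"
  using assms
proof (induction n arbitrary: F)
  case 0
  then show ?case by (auto simp: triangle_closed_def fan_words_def intro!: bexI[of _ "[]"])
next
  case (Suc n)
  define F' where "F' = F \<inter> fan_edges n"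
  have F: "F \<subseteq> fan_edges (Suc n)" using Suc.prems by (simp add: triangle_closed_def)
  have old: "{0, i} \<in> F' \<longleftrightarrow> {0, i} \<in> F" if "0 < i" "i \<le> n" for i
    using that by (auto simp: F'_def fan_edges_iff)
  have old': "{i, Suc i} \<in> F' \<longleftrightarrow> {i, Suc i} \<in> F" if "0 < i" "i < n" for i
    using that by (auto simp: F'_def fan_edges_iff)
  have tri: "{0, i} \<in> F \<Longrightarrow> {0, Suc i} \<in> F \<Longrightarrow> {i, Suc i} \<in> F"
    "{0, i} \<in> F \<Longrightarrow> {i, Suc i} \<in> F \<Longrightarrow> {0, Suc i} \<in> F"
    "{0, Suc i} \<in> F \<Longrightarrow> {i, Suc i} \<in> F \<Longrightarrow> {0, i} \<in> F" if "0 < i" "i \<le> n" for i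
    using Suc.prems that unfolding triangle_closed_def by (meson le_imp_less_Suc)+
  have "({0, i} \<in> F' \<and> {0, Suc i} \<in> F' \<longrightarrow> {i, Suc i} \<in> F') \<and>
     ({0, i} \<in> F' \<and> {i, Suc i} \<in> F' \<longrightarrow> {0, Suc i} \<in> F') \<and>
     ({0, Suc i} \<in> F' \<and> {i, Suc i} \<in> F' \<longrightarrow> {0, i} \<in> F')" if "0 < i" "i < n" for i
    using that tri[of i] old[of i] old[of "Suc i"] old'[of i] by simp
  moreover have "F' \<subseteq> fan_edges n" by (simp add: F'_def)
  ultimately have "triangle_closed n F'" unfolding triangle_closed_def by blast
  then obtain w where w: "fan_word w" "length w = n" "word_edges w = F'"
    using Suc.IH by (auto simp: fan_words_def)
  have hub: "{0, n} \<in> F \<longleftrightarrow> hd w = Hub" if "n > 0"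
    using that old[of n] w spoke_in_word_edges_iff[of w] by auto
  define x where "x = (if {0, Suc n} \<in> F then Hub else if n > 0 \<and> {n, Suc n} \<in> F then Join else New)"
  have split: "F = F' \<union> (if {0, Suc n} \<in> F then {{0, Suc n}} else {}) \<union>
      (if n > 0 \<and> {n, Suc n} \<in> F then {{n, Suc n}} else {})"
    using F by (auto simp: F'_def split: if_splits)
  have "n > 0 \<and> {n, Suc n} \<in> F \<longleftrightarrow> x = Join \<or> x = Hub \<and> w \<noteq> [] \<and> hd w = Hub"
    using hub tri[of n] w(2) by (auto simp: x_def)
  moreover have "{0, Suc n} \<in> F \<longleftrightarrow> x = Hub"
    by (simp add: x_def)
  ultimately have "word_edges (x # w) = F' \<union> (if {0, Suc n} \<in> F then {{0, Suc n}} else {}) \<union>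
      (if n > 0 \<and> {n, Suc n} \<in> F then {{n, Suc n}} else {})"
    using w by simp
  then have "word_edges (x # w) = F" by (rule trans[OF _ split[symmetric]])
  moreover have "fan_word (x # w)"
    using w hub tri[of n] by (auto simp: x_def split: if_splits)
  ultimately show ?case
    using w by (intro bexI[of _ "x # w"]) (auto simp: fan_words_def)
qed

lemma flats_fan: "flats (fan_matroid n) = word_edges ` fan_words n"
  using word_edges_flat flat_triangle_closed triangle_closed_word by fast

text \<open>Inclusion of flats as a letterwise test, so that the words above a given one can be
  built recursively. A \<open>Join\<close> may become \<open>Hub\<close> only together with its
  predecessor.\<close>

fun word_le :: "letter list \<Rightarrow> letter list \<Rightarrow> bool" where
  "word_le [] f = (f = [])"
| "word_le (x # g) [] = False"
| "word_le (x # g) (y # f) = (word_le g f \<and> (x = Hub \<longrightarrow> y = Hub) \<and>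
     (x = Join \<longrightarrow> y = Join \<or> y = Hub \<and> hd f = Hub))"

lemma word_le_length: "word_le g f \<Longrightarrow> length g = length f"
  by (induction g f rule: word_le.induct) auto

lemma word_le_antisym: "word_le g f \<Longrightarrow> word_le f g \<Longrightarrow> g = f"
proof (induction g f rule: word_le.induct)
  case (3 x g y f)
  then show ?case by (cases x; cases y) auto
qed auto

lemma word_rank_mono: "word_le g f \<Longrightarrow> word_rank g \<le> word_rank f"
proof (induction g f rule: word_le.induct)
  case (3 x g y f)
  then show ?case by (cases x; cases y) auto
qed auto

lemma word_edges_subset_iff:
  assumes "fan_word g" "fan_word f" "length g = length f"
  shows "word_edges g \<subseteq> word_edges f \<longleftrightarrow> word_le g f"
  using assms(3,1,2)
proof (induction g f rule: list_induct2)
  case (Cons x g y f)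
  let ?n = "length g"
  have IH: "word_edges g \<subseteq> word_edges f \<longleftrightarrow> word_le g f" using Cons by simp
  note g = word_edges_Cons_iff[OF Cons.prems(1)] and f = word_edges_Cons_iff[OF Cons.prems(2), folded Cons.hyps]
  show ?case
  proof
    assume le: "word_edges (x # g) \<subseteq> word_edges (y # f)"
    then have "word_edges g \<subseteq> word_edges f" using g(3) f(3) by blast
    moreover have "x = Hub \<Longrightarrow> y = Hub" using le g(1) f(1) by blast
    moreover have "y = Join \<or> y = Hub \<and> hd f = Hub" if "x = Join"
    proof -
      have "g \<noteq> []" "f \<noteq> []" using that Cons.prems(1) Cons.hyps by auto
      then show ?thesis using that le g(2) f(2) by blast
    qed
    ultimately show "word_le (x # g) (y # f)" using IH by simp
  next
    assume le: "word_le (x # g) (y # f)"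
    then have sub: "word_edges g \<subseteq> word_edges f" using IH by simp
    have "hd f = Hub" if "hd g = Hub" "g \<noteq> []"
    proof -
      have "f \<noteq> []" using that(2) Cons.hyps by auto
      then show ?thesis using that spoke_in_word_edges_iff[of g] spoke_in_word_edges_iff[of f] sub Cons by auto
    qed
    then show "word_edges (x # g) \<subseteq> word_edges (y # f)"
      using le sub Cons by (cases x; cases y) auto
  qed
qed simp

lemma inj_on_word_edges: "inj_on word_edges (fan_words n)"
proof (rule inj_onI)
  fix g f assume "g \<in> fan_words n" "f \<in> fan_words n" "word_edges g = word_edges f"
  then have "word_le g f" "word_le f g"
    using word_edges_subset_iff[of g f] word_edges_subset_iff[of f g] by (auto simp: fan_words_def)
  then show "g = f" by (rule word_le_antisym)
qed

section \<open>Sums over words\<close>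

fun open_blocks :: "letter list \<Rightarrow> nat" where
  "open_blocks [] = 0"
| "open_blocks (x # w) = (case x of Hub \<Rightarrow> 0 | Join \<Rightarrow> open_blocks w | New \<Rightarrow> Suc (open_blocks w))"

text \<open>One factor for each segment ended by a \<open>Hub\<close>. The parameter is
  \<open>fan_kl\<close> in the guess and the coefficients of \<open>fan_Z\<close> in the resulting
  sums.\<close>

fun closed_prod :: "(nat \<Rightarrow> int poly) \<Rightarrow> letter list \<Rightarrow> int poly" where
  "closed_prod f [] = 1"
| "closed_prod f (x # w) = closed_prod f w * (if x = Hub then f (open_blocks w) else 1)"

definition upper_words :: "letter list \<Rightarrow> letter list set" where
  "upper_words g = {f. fan_word f \<and> word_le g f}"

text \<open>The weight \<open>h\<close> of the segment still open is kept general: removing a letter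
  from \<open>g\<close> changes \<open>h\<close>, and \<open>h = fan_kl\<close> gives the sum of
  interest.\<close>

definition upper_sum :: "letter list \<Rightarrow> (nat \<Rightarrow> int poly) \<Rightarrow> int poly" where
  "upper_sum g h = (\<Sum>f\<in>upper_words g.
     monom 1 (word_rank f - word_rank g) * (closed_prod fan_kl f * h (open_blocks f)))"

lemma open_blocks_eq_0_iff: "fan_word w \<Longrightarrow> open_blocks w = 0 \<longleftrightarrow> w = [] \<or> hd w = Hub"
proof (induction w)
  case (Cons x w)
  then show ?case by (cases x) auto
qed simp

lemma finite_upper_words: "finite (upper_words g)"
proof -
  have "finite {f. set f \<subseteq> {Hub, Join, New} \<and> length f = length g}"
    by (rule finite_lists_length_eq) simp
  moreover have "set f \<subseteq> {Hub, Join, New}" for f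
    using letter.exhaust by blast
  ultimately show ?thesis
    using word_le_length by (elim finite_subset[rotated]) (auto simp: upper_words_def)
qed

lemma upper_words_Nil: "upper_words [] = {[]}"
  by (auto simp: upper_words_def)

lemma upper_words_Hub: "upper_words (Hub # g) = (#) Hub ` upper_words g"
proof (rule set_eqI)
  fix f show "f \<in> upper_words (Hub # g) \<longleftrightarrow> f \<in> (#) Hub ` upper_words g"
    by (cases f) (auto simp: upper_words_def)
qed

lemma upper_words_New:
  "upper_words (New # g) = (#) New ` upper_words g \<union>
     ((#) Hub ` upper_words g \<union> (#) Join ` {f \<in> upper_words g. open_blocks f > 0})"
proof (rule set_eqI)
  fix f show "f \<in> upper_words (New # g) \<longleftrightarrow> f \<in> (#) New ` upper_words g \<union>
     ((#) Hub ` upper_words g \<union> (#) Join ` {f \<in> upper_words g. open_blocks f > 0})"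
  proof (cases f)
    case (Cons y w)
    then show ?thesis
      using open_blocks_eq_0_iff[of w] by (cases y) (auto simp: upper_words_def)
  qed (auto simp: upper_words_def)
qed

text \<open>The letter above a \<open>Join\<close> is forced: the vertex must stay with its
  predecessor, which is in the hub block exactly when no block is open.\<close>

lemma upper_words_Join:
  assumes "fan_word (Join # g)"
  shows "upper_words (Join # g) = (\<lambda>f. (if open_blocks f = 0 then Hub else Join) # f) ` upper_words g"
proof (rule set_eqI)
  fix f show "f \<in> upper_words (Join # g) \<longleftrightarrow>
      f \<in> (\<lambda>f. (if open_blocks f = 0 then Hub else Join) # f) ` upper_words g"
  proof (cases f)
    case (Cons y w)
    have "w \<noteq> []" if "word_le g w" using that assms by (cases g) auto
    then show ?thesis
      using Cons open_blocks_eq_0_iff[of w] by (cases y) (auto simp: upper_words_def image_iff)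
  qed (auto simp: upper_words_def)
qed

lemma upper_sum_Hub: "upper_sum (Hub # g) h = h 0 * upper_sum g fan_kl"
  unfolding upper_sum_def upper_words_Hub sum_distrib_left
  by (subst sum.reindex) (auto intro!: sum.cong simp: mult_ac)

text \<open>A forced \<open>Hub\<close> closes an empty segment and costs
  \<open>fan_kl 0 = 1\<close>; the rank difference is unchanged in either case.\<close>

lemma upper_sum_Join:
  assumes "fan_word (Join # g)"
  shows "upper_sum (Join # g) h = upper_sum g h"
  unfolding upper_sum_def upper_words_Join[OF assms]
  by (subst sum.reindex) (auto intro!: sum.cong inj_onI)

lemma upper_sum_New: "upper_sum (New # g) h = upper_sum g (transfer_step h)"
proof -
  let ?U = "upper_words g" and ?J = "{f \<in> upper_words g. open_blocks f > 0}"
  let ?m = "\<lambda>f. monom 1 (word_rank f - word_rank g) * closed_prod fan_kl f"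
  let ?T = "\<lambda>f. monom 1 (word_rank f - word_rank (New # g)) * (closed_prod fan_kl f * h (open_blocks f))"
  have mono: "Suc (word_rank f) - word_rank g = Suc (word_rank f - word_rank g)" if "f \<in> ?U" for f
    using that word_rank_mono by (simp add: upper_words_def Suc_diff_le)
  have t: "monom 1 (Suc n) = [:0, 1:] * monom (1::int) n" for n
    by (simp add: monom_Suc)
  have "upper_sum (New # g) h = (\<Sum>f\<in>(#) New ` ?U. ?T f) + ((\<Sum>f\<in>(#) Hub ` ?U. ?T f) + (\<Sum>f\<in>(#) Join ` ?J. ?T f))"
    unfolding upper_sum_def upper_words_New
    by (subst sum.union_disjoint; (subst sum.union_disjoint)?) (auto simp: finite_upper_words)
  also have "(\<Sum>f\<in>(#) New ` ?U. ?T f) = (\<Sum>f\<in>?U. ?m f * h (Suc (open_blocks f)))"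
    by (subst sum.reindex) (auto intro!: sum.cong simp: mult_ac)
  also have "(\<Sum>f\<in>(#) Hub ` ?U. ?T f) = (\<Sum>f\<in>?U. ?m f * ([:0, 1:] * h 0 * fan_kl (open_blocks f)))"
    by (subst sum.reindex) (auto intro!: sum.cong simp: mono t mult_ac simp del: mult_pCons_left mult_pCons_right)
  also have "(\<Sum>f\<in>(#) Join ` ?J. ?T f) = (\<Sum>f\<in>?J. ?m f * ([:0, 1:] * h (open_blocks f)))"
    by (subst sum.reindex) (auto intro!: sum.cong simp: mono t mult_ac simp del: mult_pCons_left mult_pCons_right)
  also have "\<dots> = (\<Sum>f\<in>?U. ?m f * (if open_blocks f > 0 then [:0, 1:] * h (open_blocks f) else 0))"
    using finite_upper_words by (intro sum.mono_neutral_cong_left) auto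
  finally show ?thesis
    unfolding upper_sum_def transfer_step_def
    by (simp add: sum.distrib[symmetric] distrib_left mult.assoc add.commute add.left_commute del: mult_pCons_left mult_pCons_right)
qed

text \<open>The exponent \<open>a\<close> counts the \<open>New\<close> letters already removed. A
  \<open>Hub\<close> releases them as one coefficient of \<open>fan_Z\<close> and restarts with
  \<open>a = 0\<close>.\<close>

lemma upper_sum_transfer:
  "fan_word g \<Longrightarrow> upper_sum g ((transfer_step ^^ a) fan_kl) =
     closed_prod (\<lambda>k. fan_Z $ k) g * fan_Z $ (open_blocks g + a)"
proof (induction g arbitrary: a)
  case Nil
  then show ?case
    by (simp add: upper_sum_def upper_words_Nil transfer_step_power transfer_fps_def)
next
  case (Cons x g)
  show ?case
  proof (cases x)
    case Hub
    then show ?thesis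
      using Cons.IH[of 0] Cons.prems
      by (simp add: upper_sum_Hub transfer_step_power transfer_fps_def mult_ac)
  next
    case Join
    then show ?thesis
      using Cons upper_sum_Join[of g] by simp
  next
    case New
    then show ?thesis
      using Cons.IH[of "Suc a"] Cons.prems by (simp add: upper_sum_New)
  qed
qed

lemma upper_sum_fan_kl:
  "fan_word g \<Longrightarrow> upper_sum g fan_kl = closed_prod (\<lambda>k. fan_Z $ k) g * fan_Z $ open_blocks g"
  using upper_sum_transfer[of g 0] by simp

definition word_weight :: "letter list \<Rightarrow> int poly" where
  "word_weight w = closed_prod fan_kl w * fan_kl (open_blocks w)"

text \<open>Here \<open>d\<close> is the number of blocks in closed segments, since the number of
  all blocks is the number of \<open>New\<close> letters, that is, the length minus the
  rank.\<close>

lemma palindromic_closed_prod: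
  "\<exists>d. d + word_rank w + open_blocks w = length w \<and> palindromic d (closed_prod (\<lambda>k. fan_Z $ k) w)"
proof (induction w)
  case Nil
  then show ?case by (simp add: palindromic_iff_coeff)
next
  case (Cons x w)
  then obtain d where d: "d + word_rank w + open_blocks w = length w"
    "palindromic d (closed_prod (\<lambda>k. fan_Z $ k) w)" by blast
  show ?case
  proof (cases x)
    case Hub
    then show ?thesis
      using d palindromic_mult[OF d(2) palindromic_fan_Z[of "open_blocks w"]]
      by (intro exI[of _ "d + open_blocks w"]) simp
  qed (use d in \<open>auto intro!: exI[of _ d]\<close>)
qed

lemma palindromic_upper_sum:
  assumes "fan_word w"
  shows "palindromic (length w - word_rank w) (upper_sum w fan_kl)"
proof -
  obtain d where d: "d + word_rank w + open_blocks w = length w"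
    "palindromic d (closed_prod (\<lambda>k. fan_Z $ k) w)" using palindromic_closed_prod by blast
  then have "length w - word_rank w = d + open_blocks w" by simp
  then show ?thesis
    using palindromic_mult[OF d(2) palindromic_fan_Z] by (simp add: upper_sum_fan_kl[OF assms])
qed

text \<open>Strict bounds of nonempty closed segments add up. Without such a segment there is no
  slack, but the product is 1.\<close>

lemma closed_prod_degree:
  "closed_prod fan_kl w = 1 \<and> word_rank w + open_blocks w = length w \<or>
   2 * degree (closed_prod fan_kl w) + word_rank w + open_blocks w < length w"
proof (induction w)
  case (Cons x w)
  have "degree (closed_prod fan_kl w * fan_kl (open_blocks w)) \<le>
      degree (closed_prod fan_kl w) + degree (fan_kl (open_blocks w))"
    by (rule degree_mult_le)
  then show ?case
    using Cons degree_fan_kl[of "open_blocks w"] by (cases x; cases "open_blocks w = 0") auto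
qed simp

lemma word_weight_degree:
  "word_weight w = 1 \<and> word_rank w = length w \<or> 2 * degree (word_weight w) + word_rank w < length w"
  \<comment> \<open>An additional \<open>Hub\<close> closes the last segment and turns the weight
    into a closed product, raising rank and length by 1 each.\<close>
  using closed_prod_degree[of "Hub # w"] by (simp add: word_weight_def)

section \<open>The Z-polynomials of the fans\<close>

lemma word_edges_replicate_Hub: "word_edges (replicate n Hub) = fan_edges n"
  by (induction n) (auto simp: neq_Nil_conv)

lemma fan_word_replicate: "x \<noteq> Join \<Longrightarrow> fan_word (replicate n x)"
  by (induction n) auto

lemma rk_fan: "rk (fan_matroid n) = n"
proof -
  have "replicate n Hub \<in> fan_words n" by (simp add: fan_words_def fan_word_replicate)
  moreover have "word_rank (replicate n Hub) = n" by (induction n) auto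
  ultimately show ?thesis
    using rank_word_edges[of "replicate n Hub" n] by (simp add: rk_def ground_fan word_edges_replicate_Hub)
qed

lemma sum_upper_flats_fan:
  assumes g: "g \<in> fan_words n"
  shows "(\<Sum>H | H \<in> flats (fan_matroid n) \<and> word_edges g \<subseteq> H.
      monom 1 (rank_of (fan_matroid n) H - rank_of (fan_matroid n) (word_edges g)) *
        word_weight (inv_into (fan_words n) word_edges H)) = upper_sum g fan_kl"
proof -
  have sub: "upper_words g \<subseteq> fan_words n"
    using g word_le_length by (auto simp: upper_words_def fan_words_def)
  have flats: "{H. H \<in> flats (fan_matroid n) \<and> word_edges g \<subseteq> H} = word_edges ` upper_words g"
    using g word_le_length word_edges_subset_iff[of g]
    by (auto simp: flats_fan upper_words_def fan_words_def image_iff)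
  show ?thesis
    unfolding flats upper_sum_def sum.reindex[OF inj_on_subset[OF inj_on_word_edges sub]]
  proof (rule sum.cong)
    fix f assume "f \<in> upper_words g"
    then have f: "f \<in> fan_words n" using sub by blast
    show "((\<lambda>H. monom 1 (rank_of (fan_matroid n) H - rank_of (fan_matroid n) (word_edges g)) *
          word_weight (inv_into (fan_words n) word_edges H)) \<circ> word_edges) f =
        monom 1 (word_rank f - word_rank g) * (closed_prod fan_kl f * fan_kl (open_blocks f))"
      by (simp add: word_weight_def inv_into_f_f[OF inj_on_word_edges f] rank_word_edges[OF f] rank_word_edges[OF g])
  qed simp
qed

text \<open>Flats are decoded to words by \<open>inv_into\<close>, which is sound because
  \<open>word_edges\<close> is injective on fan words; the degree and palindromicity facts on words
  then meet the general criterion.\<close>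

lemma kl_poly_contraction_fan:
  assumes F: "F \<in> flats (fan_matroid n)"
  shows "kl_poly (contraction (fan_matroid n) F) = word_weight (inv_into (fan_words n) word_edges F)"
proof (rule kl_poly_contraction_eqI[OF matroid_fan F,
      where p = "\<lambda>F. word_weight (inv_into (fan_words n) word_edges F)"])
  let ?i = "inv_into (fan_words n) word_edges"
  have i: "?i F \<in> fan_words n" "word_edges (?i F) = F" "rank_of (fan_matroid n) F = word_rank (?i F)"
    if "F \<in> flats (fan_matroid n)" for F
  proof -
    have F: "F \<in> word_edges ` fan_words n" using that by (simp add: flats_fan)
    show mem: "?i F \<in> fan_words n" by (rule inv_into_into[OF F])
    show eq: "word_edges (?i F) = F" by (rule f_inv_into_f[OF F])
    show "rank_of (fan_matroid n) F = word_rank (?i F)" using rank_word_edges[OF mem] unfolding eq .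
  qed
  let ?E = "ground (fan_matroid n)"
  have "word_rank (?i ?E) = n" "length (?i ?E) = n"
    using i[OF matroid.ground_flat[OF matroid_fan]] rk_fan by (auto simp: rk_def fan_words_def)
  then show "word_weight (?i ?E) = 1"
    using word_weight_degree[of "?i ?E"] by simp
  fix F assume F: "F \<in> flats (fan_matroid n)"
  show "2 * degree (word_weight (?i F)) < rk (fan_matroid n) - rank_of (fan_matroid n) F"
    if "rank_of (fan_matroid n) F < rk (fan_matroid n)"
    using that i[OF F] word_weight_degree[of "?i F"] by (auto simp: rk_fan fan_words_def)
  show "palindromic (rk (fan_matroid n) - rank_of (fan_matroid n) F)
      (\<Sum>H | H \<in> flats (fan_matroid n) \<and> F \<subseteq> H.
        monom 1 (rank_of (fan_matroid n) H - rank_of (fan_matroid n) F) * word_weight (?i H))"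
    using sum_upper_flats_fan[OF i(1)[OF F]] palindromic_upper_sum[of "?i F"] i[OF F]
    by (simp add: rk_fan fan_words_def)
qed

lemma Z_graph_fan: "Z_graph (fan_graph n) = fan_Z $ n"
proof -
  \<comment> \<open>The word of the empty flat: its upper interval is the whole lattice, and all
    \<open>n\<close> blocks are open, so the product formula leaves a single coefficient.\<close>
  let ?w = "replicate n New"
  have w: "?w \<in> fan_words n" by (simp add: fan_words_def fan_word_replicate)
  have "word_edges ?w = {}" "word_rank ?w = 0" "open_blocks ?w = n" "closed_prod f ?w = 1" for f
    by (induction n) auto
  note w' = this
  have "Z_graph (fan_graph n) = (\<Sum>F\<in>flats (fan_matroid n). monom 1 (rank_of (fan_matroid n) F) *
      word_weight (inv_into (fan_words n) word_edges F))"
    unfolding Z_graph_def Z_poly_def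
    by (intro sum.cong) (auto simp: matroid.rk_localization[OF matroid_fan] kl_poly_contraction_fan)
  also have "\<dots> = upper_sum ?w fan_kl"
    using sum_upper_flats_fan[OF w] by (simp add: w' rank_word_edges[OF w, unfolded w'] del: closed_prod.simps)
  also have "\<dots> = fan_Z $ n"
    using w by (simp add: upper_sum_fan_kl fan_words_def w')
  finally show ?thesis .
qed

theorem theorem6p1:
  shows "let t = fps_const [:0, 1:] :: int poly fps; u = fps_X in
           to_fract (Abs_fps (\<lambda>n. Z_graph (fan_graph n))) =
           2 / to_fract (fps_sqrt ((1 - (t + 1) * u) ^ 2 - 4 * t * u ^ 2) - (t + 1) * u + 1)"
proof -
  have "Abs_fps (\<lambda>n. Z_graph (fan_graph n)) = fan_Z"
    by (rule fps_ext) (simp add: Z_graph_fan)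
  then show ?thesis
    unfolding Let_def by (simp only: to_fract_fan_Z)
qed

end
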